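(* (i) Consider the tower of differential extensions $$\mathbb{C}\langle\eta\rangle^G\hookrightarrow\mathbb{C}\langle\eta\rangle^B,\quad \mathbb{C}\langle\eta\rangle^B\hookrightarrow\mathbb{C}\langle\eta\rangle^H\hookrightarrow\mathbb{C}\langle\eta\rangle,\quad \mathbb{C}\langle\eta\rangle^B\hookrightarrow\mathbb{C}\langle\eta\rangle^N\hookrightarrow\mathbb{C}\langle\eta\rangle,\quad \mathbb{C}\langle\eta\rangle^B\hookrightarrow\mathbb{C}\langle\eta\rangle .$$ All arrows in this commutative diagram are Poisson morphisms. (ii) The basic Poisson bracket relations in $\mathbb{C}\langle\eta\rangle$ are given by $$\{\eta(x),\eta(y)\}=\eta(x)^2-\eta(y)^2-\operatorname{sign}(x-y)\,(\eta(x)-\eta(y))^2.$$ (iii) We have $\mathbb{C}\langle\eta\rangle^N\simeq\mathbb{C}\langle\theta\rangle$, where $\theta:=\eta'$; moreover, $$\{\theta(x),\theta(y)\}=2\operatorname{sign}(x-y)\,\theta(x)\theta(y).$$ (iv) The subalgebra of $B$-invariants is generated by $v:=\tfrac12\eta''/\eta'=\tfrac12\theta'/\theta$; we have $$\{v(x),v(y)\}=\tfrac12\delta'(x-y).$$ (v) The subalgebra of $G$-invariants is generated by $u=\tfrac12S(\eta)=v'-v^2$, where $S(\eta)=\frac{\eta'''}{\eta'}-\frac32\left(\frac{\eta''}{\eta'}\right)^2$; we have $$\{u(x),u(y)\}=\tfrac12\delta'''(x-y)+\delta'(x-y)\,[u(x)+u(y)].$$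
   Context: Consider quasi-periodic plane curves $w=(\phi,\psi):\mathbb{R}\to\mathbb{C}^2$ (row vectors), $w(x+2\pi)=w(x)M$, $M\in SL(2,\mathbb{C})$, and put $\eta=\phi/\psi$. The space of such curves carries the Poisson bracket of evaluation functionals $\{w_1(x),w_2(y)\}=w_1(x)w_2(y)R(x-y)$, where $w_1(x)w_2(y)=w(x)\otimes w(y)$ is a row vector of length 4 and $$R(x-y)=a(x-y)\,I+\begin{pmatrix}0&0&0&0\\0&c&-c&0\\0&-c&c&0\\0&0&0&0\end{pmatrix}+r,\qquad c=c(x-y)=\operatorname{sign}(x-y),\quad r=\epsilon(e\otimes f-f\otimes e),\ \epsilon=1,$$ with $e=\begin{pmatrix}0&1\\0&0\end{pmatrix}$, $f=\begin{pmatrix}0&0\\1&0\end{pmatrix}$ and $a$ an odd function; the brackets of $\eta$ do not depend on $a$ and are not affected by imposing the constraint that the wronskian $\phi\psi'-\phi'\psi$ equals 1. $\mathbb{C}\langle\eta\rangle$ is the differential field generated by $\eta$ (rational functions of $\eta,\eta',\eta'',\dots$), similarly $\mathbb{C}\langle\theta\rangle$. $G=SL(2,\mathbb{C})$ acts on it by $\eta\mapsto\frac{\alpha\eta+\gamma}{\beta\eta+\delta}$ for $\begin{pmatrix}\alpha&\beta\\\gamma&\delta\end{pmatrix}\in G$ (induced by $w\mapsto wg$). $B\subset G$ is the subgroup of lower triangular matrices, $N\subset B$ its unipotent subgroup, $H$ the diagonal (Cartan) subgroup, and $\mathbb{C}\langle\eta\rangle^K$ denotes the subfield of $K$-invariants.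 Primes denote $d/dx$; $\delta',\delta'''$ are derivatives of the Dirac delta function.
   Formalization: Printed (iv) and (v) contradict each other, and (ii),(iii) have the wrong sign for the given R; with sign' = 2δ the right-hand sides of (ii),(iii),(iv),(v) are multiplied by -1, -1, 2, -2 respectively. *)

theory Defs
  imports
    "HOL-Library.Poly_Mapping"
    "HOL-Library.Product_Lexorder"
    "HOL-Library.Product_Plus"
    "HOL-Computational_Algebra.Fraction_Field"
    "HOL-Computational_Algebra.Polynomial"
    "HOL-Analysis.Determinants"
begin

section \<open>Rational functions over the complex numbers in variables of type 'v\<close>

type_synonym 'v mpoly = "('v \<Rightarrow>\<^sub>0 nat) \<Rightarrow>\<^sub>0 complex"
type_synonym 'v ratfun = "'v mpoly fract"

definition cst :: "complex \<Rightarrow> 'v::linorder ratfun" where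
  "cst c = Fraction_Field.Fract (Poly_Mapping.single 0 c) 1"

definition var :: "'v::linorder \<Rightarrow> 'v ratfun" where
  "var v = Fraction_Field.Fract (Poly_Mapping.single (Poly_Mapping.single v 1) 1) 1"

definition pdiff_poly :: "'v::linorder \<Rightarrow> 'v mpoly \<Rightarrow> 'v mpoly" where
  "pdiff_poly v p = (\<Sum>m\<in>Poly_Mapping.keys p.
     Poly_Mapping.single (m - Poly_Mapping.single v 1)
       (of_nat (Poly_Mapping.lookup m v) * Poly_Mapping.lookup p m))"

text \<open>Partial derivative, by the quotient rule; the value does not depend on the
  chosen representation of the fraction.\<close>
definition pdiff :: "'v::linorder \<Rightarrow> 'v ratfun \<Rightarrow> 'v ratfun" where
  "pdiff v F = (THE z. \<exists>p q. q \<noteq> 0 \<and> F = Fraction_Field.Fract p q \<and>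
     z = Fraction_Field.Fract (pdiff_poly v p * q - p * pdiff_poly v q) (q * q))"

text \<open>The derivation that is zero on constants and sends each variable v to s v.\<close>
definition derivation :: "('v::linorder \<Rightarrow> 'v ratfun) \<Rightarrow> 'v ratfun \<Rightarrow> 'v ratfun" where
  "derivation s F = (\<Sum>v | pdiff v F \<noteq> 0. pdiff v F * s v)"

definition subst_poly :: "('v::linorder \<Rightarrow> 'u::linorder ratfun) \<Rightarrow> 'v mpoly \<Rightarrow> 'u ratfun" where
  "subst_poly s p = (\<Sum>m\<in>Poly_Mapping.keys p.
     cst (Poly_Mapping.lookup p m) * (\<Prod>v\<in>Poly_Mapping.keys m. s v ^ Poly_Mapping.lookup m v))"

text \<open>Substitution of s v for v.  It is defined on those fractions that have a representation
  whose denominator does not vanish under the substitution (unspecified elsewhere), and there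
  it does not depend on the representation.\<close>
definition subst :: "('v::linorder \<Rightarrow> 'u::linorder ratfun) \<Rightarrow> 'v ratfun \<Rightarrow> 'u ratfun" where
  "subst s F = (THE z. \<exists>p q. F = Fraction_Field.Fract p q \<and> subst_poly s q \<noteq> 0 \<and>
     z = subst_poly s p / subst_poly s q)"

text \<open>Subfields that contain the constants and are stable under all maps in Ds; the differential
  field generated by a set is the corresponding hull.\<close>
definition diff_subfield :: "('v::linorder ratfun \<Rightarrow> 'v ratfun) set \<Rightarrow> 'v ratfun set \<Rightarrow> bool" where
  "diff_subfield Ds K \<longleftrightarrow>
     range cst \<subseteq> K \<and>
     (\<forall>f\<in>K. \<forall>g\<in>K. f + g \<in> K \<and> f - g \<in> K \<and> f * g \<in> K \<and> f / g \<in> K) \<and>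
     (\<forall>D\<in>Ds. D ` K \<subseteq> K)"


section \<open>Differential functions of a plane curve, at one point and at two points\<close>

text \<open>The variable (i, k) is the k-th derivative of the component i of the row vector
  w = (phi, psi), where i = 1 is phi and i = 2 is psi.  An element of the field of one-point
  functions is a rational function of phi, psi, phi', psi', ...\<close>
type_synonym jet = "2 \<times> nat"
type_synonym onept = "jet ratfun"

definition D :: "onept \<Rightarrow> onept" where
  "D = derivation (\<lambda>(i, k). var (i, Suc k))"

text \<open>A two-point function is a rational function of the jets of w at x and of the jets of w at y;
  the boolean is False for a jet taken at x and True for a jet taken at y.\<close>
type_synonym twopt = "(bool \<times> jet) ratfun"

definition Dx :: "twopt \<Rightarrow> twopt" where
  "Dx = derivation (\<lambda>(p, i, k). if p then 0 else var (p, i, Suc k))"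

definition Dy :: "twopt \<Rightarrow> twopt" where
  "Dy = derivation (\<lambda>(p, i, k). if p then var (p, i, Suc k) else 0)"

definition at_x :: "onept \<Rightarrow> twopt" where
  "at_x = subst (\<lambda>v. var (False, v))"

definition at_y :: "onept \<Rightarrow> twopt" where
  "at_y = subst (\<lambda>v. var (True, v))"

text \<open>Restriction to x = y; meaningful for two-point functions that are regular there, for example
  sums of products at_x f * at_y g.\<close>
definition diag :: "twopt \<Rightarrow> onept" where
  "diag = subst (\<lambda>(p, v). var v)"


section \<open>Kernels\<close>

text \<open>The tuple (A, P, S, Q) stands for the kernel (generalized function of x and y)
    A(x,y) + sum_k P_k(x,y) a^(k)(x-y) + S(x,y) sign(x-y) + sum_k Q_k(x) delta^(k)(x-y),
  where a is an indeterminate function of one variable (so that whatever is proved holds in particular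
  for every odd a), P_k and Q_k are the coefficients of the
  polynomials P and Q, and delta is the Dirac delta function.  Coefficients of
  delta^(k)(x-y) are always moved to the point x, which makes the representation unique.\<close>
type_synonym kernel = "twopt \<times> twopt poly \<times> twopt \<times> onept poly"

definition fun_ker :: "twopt \<Rightarrow> kernel" where
  "fun_ker f = (f, 0, 0, 0)"

definition a_ker :: kernel where
  "a_ker = (0, 1, 0, 0)"

definition sign_ker :: kernel where
  "sign_ker = (0, 0, 1, 0)"

definition delta_ker :: "nat \<Rightarrow> kernel" where
  "delta_ker k = (0, 0, 0, monom 1 k)"

text \<open>Multiplication by a function that is regular on the diagonal, with
    f(x,y) delta^(k)(x-y) = sum_(j <= k) (k choose j) (d/dy)^j f (x,x) delta^(k-j)(x-y).\<close>
fun kscale :: "twopt \<Rightarrow> kernel \<Rightarrow> kernel" (infixr \<open>\<odot>\<close> 75) where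
  "f \<odot> (A, P, S, Q) =
     (f * A, Polynomial.smult f P, f * S,
      \<Sum>k\<le>Polynomial.degree Q. \<Sum>j\<le>k.
        monom (of_nat (k choose j) * diag ((Dy ^^ j) f) * Polynomial.coeff Q k) (k - j))"

text \<open>Derivatives of kernels with respect to x and y.  Multiplication of a polynomial by the
  indeterminate (pCons 0) raises the order of a^(k) or delta^(k) by one, and
  (d/dx) sign(x-y) = 2 delta(x-y).\<close>
fun kdx :: "kernel \<Rightarrow> kernel" where
  "kdx (A, P, S, Q) =
     (Dx A, map_poly Dx P + pCons 0 P, Dx S, map_poly D Q + pCons 0 Q + [:2 * diag S:])"

fun kdy :: "kernel \<Rightarrow> kernel" where
  "kdy (A, P, S, Q) =
     (Dy A, map_poly Dy P - pCons 0 P, Dy S, - pCons 0 Q - [:2 * diag S:])"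


section \<open>The Poisson bracket of evaluation functionals\<close>

definition kron :: "complex^2^2 \<Rightarrow> complex^2^2 \<Rightarrow> 2 \<times> 2 \<Rightarrow> 2 \<times> 2 \<Rightarrow> complex" where
  "kron m n = (\<lambda>(i, j) (k, l). m $ i $ k * n $ j $ l)"

definition e_mat :: "complex^2^2" where
  "e_mat = vector [vector [0, 1], vector [0, 0]]"

definition f_mat :: "complex^2^2" where
  "f_mat = vector [vector [0, 0], vector [1, 0]]"

definition r_mat :: "2 \<times> 2 \<Rightarrow> 2 \<times> 2 \<Rightarrow> complex" where
  "r_mat I J = kron e_mat f_mat I J - kron f_mat e_mat I J"

text \<open>Rows and columns of the 4 x 4 matrices are indexed by (1,1), (1,2), (2,1), (2,2), in this order;
  the following matrix has the block with rows (1, -1), (-1, 1) in the middle.\<close>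
definition c_mat :: "2 \<times> 2 \<Rightarrow> 2 \<times> 2 \<Rightarrow> complex" where
  "c_mat I J = (if fst I \<noteq> snd I \<and> fst J \<noteq> snd J then (if I = J then 1 else - 1) else 0)"

definition R_mat :: "2 \<times> 2 \<Rightarrow> 2 \<times> 2 \<Rightarrow> kernel" where
  "R_mat I J = (if I = J then a_ker else 0) + cst (c_mat I J) \<odot> sign_ker + fun_ker (cst (r_mat I J))"

text \<open>The entry (k, l) of the row vector {w_1(x), w_2(y)} = w(x) \<otimes> w(y) R(x-y), that is,
  the kernel {w_k(x), w_l(y)}.\<close>
definition w_bracket :: "2 \<Rightarrow> 2 \<Rightarrow> kernel" where
  "w_bracket k l = (\<Sum>i\<in>UNIV. \<Sum>j\<in>UNIV.
     (at_x (var (i, 0)) * at_y (var (j, 0))) \<odot> R_mat (i, j) (k, l))"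

text \<open>The extension to all differential functions as a derivation in each argument which is compatible with
  d/dx and d/dy.\<close>
definition bracket :: "onept \<Rightarrow> onept \<Rightarrow> kernel" where
  "bracket F G = (\<Sum>(i, k) | pdiff (i, k) F \<noteq> 0. \<Sum>(j, l) | pdiff (j, l) G \<noteq> 0.
     (at_x (pdiff (i, k) F) * at_y (pdiff (j, l) G)) \<odot> (kdx ^^ k) ((kdy ^^ l) (w_bracket i j)))"


section \<open>The field generated by the projective curve, the group and its invariants\<close>

definition eta :: onept where
  "eta = var (1, 0) / var (2, 0)"

definition theta :: onept where
  "theta = D eta"

definition v_inv :: onept where
  "v_inv = 1/2 * ((D ^^ 2) eta / D eta)"

definition schwarzian :: "onept \<Rightarrow> onept" where
  "schwarzian f = (D ^^ 3) f / D f - 3/2 * ((D ^^ 2) f / D f)\<^sup>2"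

definition u_inv :: onept where
  "u_inv = 1/2 * schwarzian eta"

definition dfield :: "onept \<Rightarrow> onept set" where
  "dfield f = diff_subfield {D} hull {f}"

text \<open>The two-point analogue of dfield eta, generated by eta(x) and eta(y).\<close>
definition dfield2_eta :: "twopt set" where
  "dfield2_eta = diff_subfield {Dx, Dy} hull {at_x eta, at_y eta}"

definition SL2 :: "(complex^2^2) set" where
  "SL2 = {g. det g = 1}"

definition lower_B :: "(complex^2^2) set" where
  "lower_B = {g \<in> SL2. g $ 1 $ 2 = 0}"

definition lower_N :: "(complex^2^2) set" where
  "lower_N = {g \<in> lower_B. g $ 1 $ 1 = 1 \<and> g $ 2 $ 2 = 1}"

definition diag_H :: "(complex^2^2) set" where
  "diag_H = {g \<in> SL2. g $ 1 $ 2 = 0 \<and> g $ 2 $ 1 = 0}"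

text \<open>Substitution of w g for w, in one-point functions and simultaneously at both points.\<close>
definition act :: "complex^2^2 \<Rightarrow> onept \<Rightarrow> onept" where
  "act g = subst (\<lambda>(i, k). \<Sum>j\<in>UNIV. cst (g $ j $ i) * var (j, k))"

definition act2 :: "complex^2^2 \<Rightarrow> twopt \<Rightarrow> twopt" where
  "act2 g = subst (\<lambda>(p, i, k). \<Sum>j\<in>UNIV. cst (g $ j $ i) * var (p, j, k))"

definition invariants :: "(complex^2^2) set \<Rightarrow> onept set" where
  "invariants K = {F \<in> dfield eta. \<forall>g\<in>K. act g F = F}"

text \<open>Kernels depending on the curve eta only, and invariant under K.  For the torus diag_H one cannot ask
  the coefficients to be built from values of invariants at x and at y separately: the
  bracket of eta'/eta with itself contains eta(x)/eta(y), which is an invariant functional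
  of the curve, namely exp of the integral of eta'/eta from y to x, but not a function
  of that kind.\<close>
definition invariant_kernels :: "(complex^2^2) set \<Rightarrow> kernel set" where
  "invariant_kernels K =
     {(A, 0, S, Q) | A S Q.
        A \<in> dfield2_eta \<and> S \<in> dfield2_eta \<and> (\<forall>g\<in>K. act2 g A = A \<and> act2 g S = S) \<and>
        (\<forall>k. Polynomial.coeff Q k \<in> invariants K)}"


section \<open>Poisson algebras of differential functions\<close>

text \<open>A pair (A, M) is a differential field A of one-point functions together with the set M of
  kernels in which its brackets are required to take values.\<close>
definition poisson_dfield :: "onept set \<times> kernel set \<Rightarrow> bool" where
  "poisson_dfield = (\<lambda>(A, M). diff_subfield {D} A \<and> (\<forall>F\<in>A. \<forall>G\<in>A. bracket F G \<in> M))"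

text \<open>Both algebras carry the restriction of the same bracket, so an inclusion preserves brackets
  as soon as both sides are closed under it.\<close>
definition poisson_inclusion :: "onept set \<times> kernel set \<Rightarrow> onept set \<times> kernel set \<Rightarrow> bool"
    (infix \<open>\<hookrightarrow>\<^sub>P\<close> 50) where
  "X \<hookrightarrow>\<^sub>P Y \<longleftrightarrow>
     poisson_dfield X \<and> poisson_dfield Y \<and> fst X \<subseteq> fst Y \<and> snd X \<subseteq> snd Y"

definition C_eta_inv :: "(complex^2^2) set \<Rightarrow> onept set \<times> kernel set" where
  "C_eta_inv K = (invariants K, invariant_kernels K)"

text \<open>With no group elements to be invariant under, this is the whole differential field generated by eta.\<close>
abbreviation C_eta :: "onept set \<times> kernel set" where
  "C_eta \<equiv> C_eta_inv {}"

end

theory Submission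
  imports Defs
begin

text \<open>The bracket is a biderivation compatible with d/dx and d/dy, so on the differential field generated by
  one function f it is determined by the kernel of f with itself, and closure of an
  invariant field under the bracket only has to be checked on a differential generator.
  From the bracket of eta one gets those of theta = eta', of the logarithmic derivatives eta'/eta
  and theta'/theta = 2 v, and of u = v' - v^2, in this order.

  The generators of the invariant fields come from one descent argument.  If L is a differential
  field of invariants and t generates a larger field over L, an element F = P(t)/Q(t) is invariant
  precisely when P(t) Q(s) = Q(t) P(s) for all translates s of t.  There are infinitely many of
  them, so this is an identity in s, and a constant s shows that F lies in L.  It is applied to
  t = eta (translations give theta, scalings give eta'/eta), to t = theta (scalings give v) and to
  t = v (which upper unitriangular matrices move, while fixing u).\<close>


section \<open>Polynomials and rational functions\<close>

text \<open>The obstacle is the Dirac part of a kernel. Multiplying it by f(x,y), and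
  differentiating sign(x-y), both need values on x = y, but \<open>diag\<close> is only a partial
  substitution: it respects sums and products where denominators survive. The kernel calculus is
  therefore run over \<open>tens\<close>, a ring without division by general two-point functions.
  The divisions that occur in a bracket are by functions of a single point and stay inside that
  ring. The other substitutions, namely evaluation at a point and the group action, have left
  inverses and are total for that reason.

  In the descent, adjoining t as a plain field element suffices because each t solves a first-order
  equation over L: eta' = theta, eta' = (eta'/eta) eta, theta' = 2 v theta, and the Riccati equation
  v' = u + v^2.\<close>

lemma mpoly_induct [case_names single add]:
  fixes p :: "'v mpoly"
  assumes single: "\<And>m c. P (Poly_Mapping.single m c)"
    and add: "\<And>p q. P p \<Longrightarrow> P q \<Longrightarrow> P (p + q)"
  shows "P p"
proof (induction p rule: update_induct)
  case const
  show ?case using single[of 0 0] by simp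
next
  case (update f a b)
  have "Poly_Mapping.update a b f = f + Poly_Mapping.single a b"
    using update(1)
    by (intro poly_mapping_eqI) (auto simp: lookup_update lookup_add lookup_single in_keys_iff)
  then show ?case using add[OF update(3) single] by simp
qed

lemma exponent_induct [case_names zero step]:
  fixes m :: "'v \<Rightarrow>\<^sub>0 nat"
  assumes zero: "P 0" and step: "\<And>v m. P m \<Longrightarrow> P (Poly_Mapping.single v 1 + m)"
  shows "P m"
proof (induction m rule: update_induct)
  case const
  show ?case by (rule zero)
next
  case (update f a b)
  have "P (Poly_Mapping.single a n + f)" for n
  proof (induction n)
    case 0
    then show ?case using update by simp
  next
    case (Suc n)
    have "Poly_Mapping.single a (Suc n) = Poly_Mapping.single a 1 + Poly_Mapping.single a n"
      by (simp add: single_add[symmetric])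
    then show ?case using step[OF Suc, of a] by (simp add: add.assoc)
  qed
  moreover have "Poly_Mapping.update a b f = Poly_Mapping.single a b + f"
    using update(1)
    by (intro poly_mapping_eqI) (auto simp: lookup_update lookup_add lookup_single in_keys_iff)
  ultimately show ?case by simp
qed

lemma cst_0 [simp]: "cst 0 = 0"
  and cst_1 [simp]: "cst 1 = 1"
  and cst_add: "cst (a + b) = cst a + cst b"
  and cst_mult: "cst (a * b) = cst a * cst b"
  and cst_uminus: "cst (- a) = - cst a"
  by (simp_all add: cst_def fract_collapse single_add mult_single single_uminus)

lemma cst_diff: "cst (a - b) = cst a - cst b"
  using cst_add[of a "- b"] by (simp add: cst_uminus)

lemma cst_eq_iff [simp]: "cst a = cst b \<longleftrightarrow> a = b"
  by (auto simp: cst_def eq_fract dest: injD[OF inj_single])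

lemma cst_eq_0_iff [simp]: "cst a = 0 \<longleftrightarrow> a = 0"
  using cst_eq_iff[of a 0] by (simp del: cst_eq_iff)

lemma cst_of_nat: "cst (of_nat n) = of_nat n"
  by (induction n) (simp_all add: cst_add)

lemma cst_numeral: "cst (numeral n) = numeral n"
  using cst_of_nat[of "numeral n"] by simp

lemma cst_inverse: "cst (inverse a) = inverse (cst a)"
proof (cases "a = 0")
  case False
  then have "cst a * cst (inverse a) = 1" by (simp add: cst_mult[symmetric])
  then show ?thesis by (metis inverse_unique)
qed simp

lemma cst_divide: "cst (a / b) = cst a / cst b"
  by (simp add: divide_inverse cst_mult cst_inverse)

lemma ratfun_numeral_neq_0 [simp]: "(numeral n :: 'v::linorder ratfun) \<noteq> 0"
  using cst_eq_0_iff[of "numeral n", where 'a='v] by (simp add: cst_numeral del: cst_eq_0_iff)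


subsection \<open>Substitution\<close>

definition exponent_eval :: "('v \<Rightarrow> 'r::comm_monoid_mult) \<Rightarrow> ('v \<Rightarrow>\<^sub>0 nat) \<Rightarrow> 'r" where
  "exponent_eval s m = (\<Prod>v\<in>Poly_Mapping.keys m. s v ^ Poly_Mapping.lookup m v)"

text \<open>Variables outside the support contribute s v ^ 0 = 1, so monomials with different
  supports can be evaluated over a common set.\<close>

lemma exponent_eval_superset:
  "finite V \<Longrightarrow> Poly_Mapping.keys m \<subseteq> V \<Longrightarrow>
    exponent_eval s m = (\<Prod>v\<in>V. s v ^ Poly_Mapping.lookup m v)"
  unfolding exponent_eval_def by (rule prod.mono_neutral_left) (auto simp: in_keys_iff)

lemma exponent_eval_add: "exponent_eval s (m + n) = exponent_eval s m * exponent_eval s n"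
proof -
  let ?V = "Poly_Mapping.keys m \<union> Poly_Mapping.keys n"
  have "Poly_Mapping.keys (m + n) \<subseteq> ?V" by (rule keys_add)
  then show ?thesis
    by (simp add: exponent_eval_superset[of ?V] lookup_add power_add prod.distrib)
qed

lemma exponent_eval_0 [simp]: "exponent_eval s 0 = 1"
  by (simp add: exponent_eval_def)

lemma exponent_eval_single [simp]: "exponent_eval s (Poly_Mapping.single v 1) = s v"
  by (simp add: exponent_eval_def)

lemma subst_poly_eval:
  "subst_poly s p = (\<Sum>m\<in>Poly_Mapping.keys p. cst (Poly_Mapping.lookup p m) * exponent_eval s m)"
  by (simp add: subst_poly_def exponent_eval_def)

lemma subst_poly_single [simp]: "subst_poly s (Poly_Mapping.single m c) = cst c * exponent_eval s m"
  by (simp add: subst_poly_eval)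

lemma subst_poly_0 [simp]: "subst_poly s 0 = 0"
  by (simp add: subst_poly_def)

lemma subst_poly_1 [simp]: "subst_poly s 1 = 1"
  using subst_poly_single[of s 0 1] by simp

lemma subst_poly_add: "subst_poly s (p + q) = subst_poly s p + subst_poly s q"
  unfolding subst_poly_eval
  by (rule setsum_keys_plus_distrib) (simp_all add: cst_add algebra_simps)

lemma subst_poly_mult: "subst_poly s (p * q) = subst_poly s p * subst_poly s q"
proof (induction p rule: mpoly_induct)
  case (single m c)
  show ?case
    by (induction q rule: mpoly_induct)
      (simp_all add: mult_single cst_mult exponent_eval_add subst_poly_add algebra_simps)
next
  case (add p p')
  then show ?case by (simp add: subst_poly_add algebra_simps)
qed

text \<open>Read backwards, this writes an embedded polynomial in terms of constants and variables,
  which is what \<open>ratfun_induct\<close> needs.\<close>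

lemma subst_poly_var: "subst_poly var p = Fraction_Field.Fract p 1"
proof (induction p rule: mpoly_induct)
  case (single m c)
  have "exponent_eval var m = Fraction_Field.Fract (Poly_Mapping.single m 1) 1"
    by (induction m rule: exponent_induct)
      (simp_all only: exponent_eval_0 exponent_eval_add exponent_eval_single,
       simp_all add: fract_collapse var_def mult_single)
  then show ?case by (simp add: cst_def mult_single)
qed (simp add: subst_poly_add)

text \<open>The fractions on which the description operator in \<open>subst\<close> denotes
  something. For instance, \<open>diag\<close> has no value at the inverse of
  \<open>at_x eta - at_y eta\<close>.\<close>

definition subst_regular :: "('v::linorder \<Rightarrow> 'u::linorder ratfun) \<Rightarrow> 'v ratfun \<Rightarrow> bool" where
  "subst_regular s F \<longleftrightarrow> (\<exists>p q. F = Fraction_Field.Fract p q \<and> subst_poly s q \<noteq> 0)"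

text \<open>Two representations satisfy p q' = p' q. The ring homomorphism
  \<open>subst_poly s\<close> preserves this relation, so the quotients agree whenever both
  denominators survive.\<close>

lemma subst_Fract:
  assumes "subst_poly s q \<noteq> 0"
  shows "subst s (Fraction_Field.Fract p q) = subst_poly s p / subst_poly s q"
  unfolding subst_def
proof (rule the_equality)
  show "\<exists>p' q'. Fraction_Field.Fract p q = Fraction_Field.Fract p' q' \<and> subst_poly s q' \<noteq> 0 \<and>
      subst_poly s p / subst_poly s q = subst_poly s p' / subst_poly s q'"
    using assms by blast
next
  fix z
  assume "\<exists>p' q'. Fraction_Field.Fract p q = Fraction_Field.Fract p' q' \<and> subst_poly s q' \<noteq> 0 \<and>
      z = subst_poly s p' / subst_poly s q'"
  then obtain p' q' where h: "Fraction_Field.Fract p q = Fraction_Field.Fract p' q'"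
    "subst_poly s q' \<noteq> 0" "z = subst_poly s p' / subst_poly s q'"
    by blast
  have "q \<noteq> 0" "q' \<noteq> 0" using assms h by auto
  then have "subst_poly s (p * q') = subst_poly s (p' * q)"
    using h(1) by (simp add: eq_fract)
  then show "z = subst_poly s p / subst_poly s q"
    unfolding h(3) using assms h(2) by (simp add: subst_poly_mult frac_eq_eq)
qed

lemma subst_regular_cases:
  assumes "subst_regular s F"
  obtains p q where "F = Fraction_Field.Fract p q" "subst_poly s q \<noteq> 0" "q \<noteq> 0"
    "subst s F = subst_poly s p / subst_poly s q"
proof -
  obtain p q where h: "F = Fraction_Field.Fract p q" "subst_poly s q \<noteq> 0"
    using assms by (auto simp: subst_regular_def)
  moreover have "q \<noteq> 0" using h by auto
  ultimately show thesis using that subst_Fract by blast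
qed

lemma subst_regularI:
  "subst_poly s q \<noteq> 0 \<Longrightarrow> subst_regular s (Fraction_Field.Fract p q)"
  by (auto simp: subst_regular_def)

lemma subst_regular_cst [simp]: "subst_regular s (cst c)"
  and subst_cst [simp]: "subst s (cst c) = cst c"
  and subst_regular_var [simp]: "subst_regular s (var v)"
  and subst_var [simp]: "subst s (var v) = s v"
proof -
  show "subst_regular s (cst c)" "subst_regular s (var v)"
    unfolding cst_def var_def by (auto intro!: subst_regularI)
  show "subst s (cst c) = cst c"
    unfolding cst_def by (subst subst_Fract) (simp_all add: cst_def)
  show "subst s (var v) = s v"
    unfolding var_def by (subst subst_Fract) (simp_all only: subst_poly_1 subst_poly_single exponent_eval_single, simp_all)
qed

lemma subst_0 [simp]: "subst s 0 = 0"
  and subst_1 [simp]: "subst s 1 = 1"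
  using subst_cst[of s 0] subst_cst[of s 1] by simp_all

lemma subst_regular_add:
  assumes "subst_regular s F" "subst_regular s G"
  shows "subst_regular s (F + G)" "subst s (F + G) = subst s F + subst s G"
proof -
  obtain p q where F: "F = Fraction_Field.Fract p q" "subst_poly s q \<noteq> 0" "q \<noteq> 0"
    "subst s F = subst_poly s p / subst_poly s q"
    using assms(1) by (rule subst_regular_cases)
  obtain p' q' where G: "G = Fraction_Field.Fract p' q'" "subst_poly s q' \<noteq> 0" "q' \<noteq> 0"
    "subst s G = subst_poly s p' / subst_poly s q'"
    using assms(2) by (rule subst_regular_cases)
  have FG: "F + G = Fraction_Field.Fract (p * q' + p' * q) (q * q')" using F G by simp
  have nz: "subst_poly s (q * q') \<noteq> 0" using F G by (simp add: subst_poly_mult)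
  show "subst_regular s (F + G)" unfolding FG using nz by (rule subst_regularI)
  show "subst s (F + G) = subst s F + subst s G"
    unfolding FG subst_Fract[OF nz]
    using F G by (simp add: subst_poly_mult subst_poly_add field_simps)
qed

lemma subst_regular_mult:
  assumes "subst_regular s F" "subst_regular s G"
  shows "subst_regular s (F * G)" "subst s (F * G) = subst s F * subst s G"
proof -
  obtain p q where F: "F = Fraction_Field.Fract p q" "subst_poly s q \<noteq> 0" "q \<noteq> 0"
    "subst s F = subst_poly s p / subst_poly s q"
    using assms(1) by (rule subst_regular_cases)
  obtain p' q' where G: "G = Fraction_Field.Fract p' q'" "subst_poly s q' \<noteq> 0" "q' \<noteq> 0"
    "subst s G = subst_poly s p' / subst_poly s q'"
    using assms(2) by (rule subst_regular_cases)
  have FG: "F * G = Fraction_Field.Fract (p * p') (q * q')" using F G by simp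
  have nz: "subst_poly s (q * q') \<noteq> 0" using F G by (simp add: subst_poly_mult)
  show "subst_regular s (F * G)" unfolding FG using nz by (rule subst_regularI)
  show "subst s (F * G) = subst s F * subst s G"
    unfolding FG subst_Fract[OF nz]
    using F G by (simp add: subst_poly_mult)
qed

lemma subst_regular_inverse:
  assumes "subst_regular s F" "subst s F \<noteq> 0"
  shows "subst_regular s (inverse F)"
proof -
  obtain p q where F: "F = Fraction_Field.Fract p q" "subst_poly s q \<noteq> 0" "q \<noteq> 0"
    "subst s F = subst_poly s p / subst_poly s q"
    using assms(1) by (rule subst_regular_cases)
  then have "subst_poly s p \<noteq> 0" using assms(2) by simp
  then show ?thesis using F(1) by (auto intro: subst_regularI)
qed

text \<open>Reduces statements about all fractions to constants and variables. It is how
  homomorphisms and derivations are compared below.\<close>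

lemma ratfun_induct [case_names cst var add mult inverse]:
  fixes F :: "'v::linorder ratfun"
  assumes cst: "\<And>c. P (cst c)" and var: "\<And>v. P (var v)"
    and add: "\<And>f g. P f \<Longrightarrow> P g \<Longrightarrow> P (f + g)"
    and mult: "\<And>f g. P f \<Longrightarrow> P g \<Longrightarrow> P (f * g)"
    and inv: "\<And>f. P f \<Longrightarrow> f \<noteq> 0 \<Longrightarrow> P (inverse f)"
  shows "P F"
proof -
  have emb: "P (Fraction_Field.Fract p 1)" for p :: "'v mpoly"
  proof (induction p rule: mpoly_induct)
    case (single m c)
    have "P (exponent_eval var m)"
      by (induction m rule: exponent_induct)
        (simp_all only: exponent_eval_0 exponent_eval_add exponent_eval_single mult var,
         metis cst cst_1)
    moreover have "Fraction_Field.Fract (Poly_Mapping.single m c) 1 = cst c * exponent_eval var m"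
      unfolding subst_poly_var[symmetric] by simp
    ultimately show ?case using mult cst by simp
  next
    case (add p q)
    have "Fraction_Field.Fract (p + q) 1 = Fraction_Field.Fract p 1 + Fraction_Field.Fract q 1" by simp
    then show ?case using assms(3) add by metis
  qed
  obtain p q where F: "F = Fraction_Field.Fract p q" "q \<noteq> 0" by (cases F) auto
  have "F = Fraction_Field.Fract p 1 * inverse (Fraction_Field.Fract q 1)"
    using F by simp
  moreover have "Fraction_Field.Fract q 1 \<noteq> 0" using F(2) by (simp add: Zero_fract_def eq_fract)
  ultimately show ?thesis using mult inv emb by metis
qed

text \<open>A left inverse \<open>t\<close> prevents \<open>s\<close> from killing a nonzero
  function, so no denominator vanishes and \<open>subst s\<close> is total. The map \<open>t\<close>
  itself may be partial: for \<open>at_x\<close> it is the restriction to the diagonal.\<close>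

lemma subst_left_inverse:
  assumes "\<And>v. subst_regular t (s v) \<and> subst t (s v) = var v"
  shows "subst_regular s F" "subst_regular t (subst s F)" "subst t (subst s F) = F"
proof -
  have "subst_regular s F \<and> subst_regular t (subst s F) \<and> subst t (subst s F) = F"
  proof (induction F rule: ratfun_induct)
    case (add f g)
    then show ?case by (simp add: subst_regular_add)
  next
    case (mult f g)
    then show ?case by (simp add: subst_regular_mult)
  next
    case (inverse f)
    \<comment> \<open>Otherwise \<open>subst t\<close> would return 0 instead of
      \<open>f\<close>.\<close>
    have nz: "subst s f \<noteq> 0" using inverse by auto
    have reg: "subst_regular s (inverse f)" using inverse nz subst_regular_inverse by blast
    have "subst s (inverse f) * subst s f = subst s (inverse f * f)"
      using subst_regular_mult(2) reg inverse(1) by metis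
    also have "\<dots> = 1" using \<open>f \<noteq> 0\<close> by simp
    finally have i: "subst s (inverse f) = inverse (subst s f)"
      by (metis inverse_unique mult.commute)
    have reg2: "subst_regular t (subst s (inverse f))"
      unfolding i using inverse by (intro subst_regular_inverse) auto
    have "subst t (subst s (inverse f)) * subst t (subst s f) = subst t (subst s (inverse f) * subst s f)"
      using subst_regular_mult(2) reg2 inverse(1) by metis
    also have "\<dots> = 1" using nz i by simp
    finally have "subst t (subst s (inverse f)) = inverse f"
      using inverse by (metis inverse_unique mult.commute)
    then show ?case using reg reg2 by simp
  qed (simp_all add: assms)
  then show "subst_regular s F" "subst_regular t (subst s F)" "subst t (subst s F) = F" by auto
qed


subsection \<open>Derivations\<close>

lemma pdiff_poly_single [simp]:
  "pdiff_poly v (Poly_Mapping.single m c) =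
    Poly_Mapping.single (m - Poly_Mapping.single v 1) (of_nat (Poly_Mapping.lookup m v) * c)"
  by (simp add: pdiff_poly_def)

lemma pdiff_poly_add: "pdiff_poly v (p + q) = pdiff_poly v p + pdiff_poly v q"
  unfolding pdiff_poly_def
  by (rule setsum_keys_plus_distrib) (simp_all add: single_add algebra_simps)

lemma exponent_minus_single:
  fixes m n :: "'v \<Rightarrow>\<^sub>0 nat"
  assumes "Poly_Mapping.lookup m v \<noteq> 0"
  shows "m + n - Poly_Mapping.single v 1 = (m - Poly_Mapping.single v 1) + n"
  using assms by (intro poly_mapping_eqI) (auto simp: lookup_add lookup_minus lookup_single when_def)

text \<open>Subtraction of exponents is truncated: if \<open>v\<close> does not occur in
  \<open>m\<close>, then \<open>m - single v 1\<close> is still \<open>m\<close>. Such terms carry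
  the coefficient \<open>lookup m v\<close> = 0, which is why the computation on monomials splits on
  that number.\<close>

lemma pdiff_poly_mult: "pdiff_poly v (p * q) = pdiff_poly v p * q + p * pdiff_poly v q"
proof (induction p rule: mpoly_induct)
  case (single m c)
  show ?case
  proof (induction q rule: mpoly_induct)
    case (single n d)
    let ?s = "Poly_Mapping.single v (1::nat)"
    have "Poly_Mapping.single (m + n - ?s) (of_nat (Poly_Mapping.lookup m v) * (c * d))
        = Poly_Mapping.single (m - ?s + n) (of_nat (Poly_Mapping.lookup m v) * (c * d))"
      using exponent_minus_single[of m v n] by (cases "Poly_Mapping.lookup m v = 0") auto
    moreover have "Poly_Mapping.single (m + n - ?s) (of_nat (Poly_Mapping.lookup n v) * (c * d))
        = Poly_Mapping.single (m + (n - ?s)) (of_nat (Poly_Mapping.lookup n v) * (c * d))"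
      using exponent_minus_single[of n v m] by (cases "Poly_Mapping.lookup n v = 0") (auto simp: add.commute)
    ultimately show ?case
      by (simp add: mult_single lookup_add single_add algebra_simps)
  qed (simp add: pdiff_poly_add algebra_simps)
qed (simp add: pdiff_poly_add algebra_simps)

text \<open>Differentiating the cross relation \<open>e\<close> of two representations gives
  \<open>e'\<close>. Equality of the two quotient rules is an algebraic consequence of
  \<open>e\<close> and \<open>e'\<close>.\<close>

lemma pdiff_Fract:
  assumes "q \<noteq> 0"
  shows "pdiff v (Fraction_Field.Fract p q) =
    Fraction_Field.Fract (pdiff_poly v p * q - p * pdiff_poly v q) (q * q)"
  unfolding pdiff_def
proof (rule the_equality)
  show "\<exists>p' q'. q' \<noteq> 0 \<and> Fraction_Field.Fract p q = Fraction_Field.Fract p' q' \<and>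
      Fraction_Field.Fract (pdiff_poly v p * q - p * pdiff_poly v q) (q * q) =
      Fraction_Field.Fract (pdiff_poly v p' * q' - p' * pdiff_poly v q') (q' * q')"
    using assms by blast
next
  fix z
  assume "\<exists>p' q'. q' \<noteq> 0 \<and> Fraction_Field.Fract p q = Fraction_Field.Fract p' q' \<and>
      z = Fraction_Field.Fract (pdiff_poly v p' * q' - p' * pdiff_poly v q') (q' * q')"
  then obtain p' q' where h: "q' \<noteq> 0" "Fraction_Field.Fract p q = Fraction_Field.Fract p' q'"
    "z = Fraction_Field.Fract (pdiff_poly v p' * q' - p' * pdiff_poly v q') (q' * q')"
    by blast
  have e: "p * q' = p' * q" using h assms by (simp add: eq_fract)
  have e': "pdiff_poly v p * q' + p * pdiff_poly v q' = pdiff_poly v p' * q + p' * pdiff_poly v q"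
    using arg_cong[OF e, of "pdiff_poly v"] by (simp only: pdiff_poly_mult)
  show "z = Fraction_Field.Fract (pdiff_poly v p * q - p * pdiff_poly v q) (q * q)"
    using h(1) assms e e' unfolding h(3) by (simp add: eq_fract) algebra
qed

lemma pdiff_add: "pdiff v (F + G) = pdiff v F + pdiff v G"
proof -
  obtain p q where F: "F = Fraction_Field.Fract p q" "q \<noteq> 0" by (cases F) auto
  obtain p' q' where G: "G = Fraction_Field.Fract p' q'" "q' \<noteq> 0" by (cases G) auto
  show ?thesis using F G
    by (simp add: pdiff_Fract eq_fract pdiff_poly_mult pdiff_poly_add algebra_simps)
qed

lemma pdiff_mult: "pdiff v (F * G) = pdiff v F * G + F * pdiff v G"
proof -
  obtain p q where F: "F = Fraction_Field.Fract p q" "q \<noteq> 0" by (cases F) auto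
  obtain p' q' where G: "G = Fraction_Field.Fract p' q'" "q' \<noteq> 0" by (cases G) auto
  show ?thesis using F G
    by (simp add: pdiff_Fract eq_fract pdiff_poly_mult algebra_simps)
qed

lemma pdiff_cst [simp]: "pdiff v (cst c) = 0"
proof -
  have "pdiff_poly v 1 = 0" using pdiff_poly_single[of v 0 1] by simp
  then show ?thesis unfolding cst_def by (simp add: pdiff_Fract fract_collapse)
qed

lemma pdiff_var: "pdiff v (var u) = (if v = u then 1 else 0)"
proof -
  have "pdiff_poly v 1 = 0" using pdiff_poly_single[of v 0 1] by simp
  then show ?thesis unfolding var_def
    by (simp add: pdiff_Fract fract_collapse lookup_single when_def)
qed

text \<open>Derivations are taken along a homomorphism \<open>h\<close> between possibly different
  fields, so that composites such as \<open>Dx (at_x f)\<close> are covered. Linearity over the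
  constants is not included; comparisons of derivations therefore test constants as well as
  variables.\<close>

definition is_derivation :: "('a::field \<Rightarrow> 'b::field) \<Rightarrow> ('a \<Rightarrow> 'b) \<Rightarrow> bool" where
  "is_derivation h d \<longleftrightarrow>
    (\<forall>f g. d (f + g) = d f + d g) \<and> (\<forall>f g. d (f * g) = d f * h g + h f * d g)"

definition is_field_hom :: "('a::field \<Rightarrow> 'b::field) \<Rightarrow> bool" where
  "is_field_hom h \<longleftrightarrow> h 1 = 1 \<and> (\<forall>f g. h (f + g) = h f + h g) \<and> (\<forall>f g. h (f * g) = h f * h g)"

context
  fixes h :: "'a::field \<Rightarrow> 'b::field"
  assumes h: "is_field_hom h"
begin

lemma field_hom_1: "h 1 = 1"
  and field_hom_add: "h (f + g) = h f + h g"
  and field_hom_mult: "h (f * g) = h f * h g"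
  using h by (auto simp: is_field_hom_def)

lemma field_hom_0: "h 0 = 0"
  using field_hom_add[of 0 0] by (metis add.right_neutral add_left_cancel)

lemma field_hom_uminus: "h (- f) = - h f"
  using field_hom_add[of f "- f"] by (simp add: field_hom_0 eq_neg_iff_add_eq_0 add.commute)

lemma field_hom_diff: "h (f - g) = h f - h g"
  using field_hom_add[of f "- g"] by (simp add: field_hom_uminus)

lemma field_hom_inverse: "h (inverse f) = inverse (h f)"
proof (cases "f = 0")
  case False
  then have "h f * h (inverse f) = 1" by (simp add: field_hom_mult[symmetric] field_hom_1)
  then show ?thesis by (metis inverse_unique)
qed (simp add: field_hom_0)

lemma field_hom_divide: "h (f / g) = h f / h g"
  by (simp add: divide_inverse field_hom_mult field_hom_inverse)

lemma field_hom_eq_0_iff: "h f = 0 \<longleftrightarrow> f = 0"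
proof
  assume "h f = 0"
  then have "h (f * inverse f) = 0" by (simp add: field_hom_mult)
  then show "f = 0" using field_hom_1 by (metis right_inverse zero_neq_one)
qed (simp add: field_hom_0)

lemma field_hom_power: "h (f ^ n) = h f ^ n"
  by (induction n) (simp_all add: field_hom_1 field_hom_mult)

lemma field_hom_of_nat: "h (of_nat n) = of_nat n"
  by (induction n) (simp_all add: field_hom_0 field_hom_1 field_hom_add)

lemma field_hom_numeral: "h (numeral n) = numeral n"
  using field_hom_of_nat[of "numeral n"] by simp

end

lemmas field_hom_simps = field_hom_1 field_hom_add field_hom_mult field_hom_0 field_hom_uminus
  field_hom_diff field_hom_inverse field_hom_divide field_hom_eq_0_iff field_hom_power
  field_hom_numeral

lemma is_field_hom_id: "is_field_hom (\<lambda>x. x)"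
  by (simp add: is_field_hom_def)

context
  fixes h d :: "'a::field \<Rightarrow> 'b::field"
  assumes h: "is_field_hom h" and d: "is_derivation h d"
begin

lemma derivation_add: "d (f + g) = d f + d g"
  and derivation_mult: "d (f * g) = d f * h g + h f * d g"
  using d by (auto simp: is_derivation_def)

lemma derivation_0: "d 0 = 0"
  using derivation_add[of 0 0] by (metis add.right_neutral add_left_cancel)

lemma derivation_uminus: "d (- f) = - d f"
  using derivation_add[of f "- f"] by (simp add: derivation_0 eq_neg_iff_add_eq_0 add.commute)

lemma derivation_diff: "d (f - g) = d f - d g"
  using derivation_add[of f "- g"] by (simp add: derivation_uminus)

lemma derivation_1: "d 1 = 0"
  using derivation_mult[of 1 1]
  by (metis add.right_neutral add_left_cancel field_hom_1[OF h] mult.left_neutral mult.right_neutral)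

lemma derivation_of_nat: "d (of_nat n) = 0"
  by (induction n) (simp_all add: derivation_0 derivation_1 derivation_add)

lemma derivation_numeral: "d (numeral n) = 0"
  using derivation_of_nat[of "numeral n"] by simp

lemma derivation_inverse:
  assumes "f \<noteq> 0"
  shows "d (inverse f) = - d f / (h f)\<^sup>2"
proof -
  have nz: "h f \<noteq> 0" using assms by (simp add: field_hom_eq_0_iff[OF h])
  have "d (inverse f * f) = 0" using assms by (simp add: derivation_1)
  then have "d (inverse f) * h f = - (inverse (h f) * d f)"
    by (simp only: derivation_mult field_hom_inverse[OF h] eq_neg_iff_add_eq_0)
  then show ?thesis using nz by (simp add: field_simps power2_eq_square)
qed

lemma derivation_divide:
  assumes "g \<noteq> 0"
  shows "d (f / g) = (d f * h g - h f * d g) / (h g)\<^sup>2"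
proof -
  have nz: "h g \<noteq> 0" using assms by (simp add: field_hom_eq_0_iff[OF h])
  have "d (f / g) = d f * inverse (h g) + h f * (- d g / (h g)\<^sup>2)"
    by (simp only: divide_inverse[of f] derivation_mult derivation_inverse[OF assms]
      field_hom_inverse[OF h])
  then show ?thesis using nz by (simp add: field_simps power2_eq_square)
qed

lemma derivation_power2: "d (f\<^sup>2) = 2 * h f * d f"
  by (simp add: power2_eq_square derivation_mult algebra_simps)

end

lemma derivation_eqI:
  fixes h d d' :: "'v::linorder ratfun \<Rightarrow> 'b::field"
  assumes "is_field_hom h" "is_derivation h d" "is_derivation h d'"
    and "\<And>c. d (cst c) = d' (cst c)" "\<And>v. d (var v) = d' (var v)"
  shows "d F = d' F"
proof (induction F rule: ratfun_induct)
  case (add f g)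
  then show ?case using assms(2,3) by (simp add: is_derivation_def)
next
  case (mult f g)
  then show ?case using assms(2,3) by (simp add: is_derivation_def)
next
  case (inverse f)
  then show ?case
    by (simp add: derivation_inverse[OF assms(1,2)] derivation_inverse[OF assms(1,3)])
qed (simp_all add: assms)

lemma field_hom_eqI:
  fixes h h' :: "'v::linorder ratfun \<Rightarrow> 'b::field"
  assumes "is_field_hom h" "is_field_hom h'"
    and "\<And>c. h (cst c) = h' (cst c)" "\<And>v. h (var v) = h' (var v)"
  shows "h F = h' F"
  by (induction F rule: ratfun_induct) (simp_all add: assms(3,4) field_hom_simps[OF assms(1)] field_hom_simps[OF assms(2)])

lemma is_derivation_pdiff: "is_derivation (\<lambda>f. f) (pdiff v)"
  by (simp add: is_derivation_def pdiff_add pdiff_mult)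

lemma finite_pdiff: "finite {v. pdiff v F \<noteq> 0}"
proof (induction F rule: ratfun_induct)
  case (var u)
  show ?case by (rule finite_subset[of _ "{u}"]) (auto simp: pdiff_var)
next
  case (add f g)
  show ?case by (rule finite_subset[OF _ finite_UnI[OF add]]) (auto simp: pdiff_add)
next
  case (mult f g)
  show ?case by (rule finite_subset[OF _ finite_UnI[OF mult]]) (auto simp: pdiff_mult)
next
  case (inverse f)
  show ?case
    by (rule finite_subset[OF _ inverse(1)])
      (auto simp: derivation_inverse[OF is_field_hom_id is_derivation_pdiff inverse(2)])
qed simp

lemma derivation_superset:
  "finite V \<Longrightarrow> {v. pdiff v F \<noteq> 0} \<subseteq> V \<Longrightarrow> derivation s F = (\<Sum>v\<in>V. pdiff v F * s v)"
  unfolding derivation_def by (rule sum.mono_neutral_left) auto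

lemma is_derivation_derivation: "is_derivation (\<lambda>f. f) (derivation s)"
  unfolding is_derivation_def
proof (intro conjI allI)
  fix f g :: "'a ratfun"
  let ?V = "{v. pdiff v f \<noteq> 0} \<union> {v. pdiff v g \<noteq> 0}"
  have fin: "finite ?V" by (simp add: finite_pdiff)
  have "derivation s (f + g) = (\<Sum>v\<in>?V. pdiff v (f + g) * s v)"
    by (rule derivation_superset[OF fin]) (auto simp: pdiff_add)
  then show "derivation s (f + g) = derivation s f + derivation s g"
    by (simp add: derivation_superset[OF fin] pdiff_add sum.distrib algebra_simps)
  have "derivation s (f * g) = (\<Sum>v\<in>?V. pdiff v (f * g) * s v)"
    by (rule derivation_superset[OF fin]) (auto simp: pdiff_mult)
  then show "derivation s (f * g) = derivation s f * g + f * derivation s g"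
    by (simp add: derivation_superset[OF fin] pdiff_mult sum.distrib sum_distrib_left
      sum_distrib_right algebra_simps)
qed

lemma derivation_cst [simp]: "derivation s (cst c) = 0"
  by (simp add: derivation_def)

lemma derivation_var [simp]: "derivation s (var v) = s v"
proof -
  have "derivation s (var v) = (\<Sum>u\<in>{v}. pdiff u (var v) * s u)"
    by (rule derivation_superset) (auto simp: pdiff_var)
  then show ?thesis by (simp add: pdiff_var)
qed

lemma is_field_hom_subst:
  assumes "\<And>F. subst_regular s F"
  shows "is_field_hom (subst s)"
  by (simp add: is_field_hom_def assms subst_regular_add subst_regular_mult)

section \<open>One-point and two-point functions\<close>

lemma is_derivation_D: "is_derivation (\<lambda>f. f) D"
  and is_derivation_Dx: "is_derivation (\<lambda>f. f) Dx"
  and is_derivation_Dy: "is_derivation (\<lambda>f. f) Dy"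
  by (simp_all add: D_def Dx_def Dy_def is_derivation_derivation)

lemmas D_rules =
  derivation_0[OF is_field_hom_id is_derivation_D]
  derivation_1[OF is_field_hom_id is_derivation_D]
  derivation_numeral[OF is_field_hom_id is_derivation_D]
  derivation_add[OF is_field_hom_id is_derivation_D]
  derivation_diff[OF is_field_hom_id is_derivation_D]
  derivation_uminus[OF is_field_hom_id is_derivation_D]
  derivation_mult[OF is_field_hom_id is_derivation_D]
  derivation_power2[OF is_field_hom_id is_derivation_D]

lemmas D_divide = derivation_divide[OF is_field_hom_id is_derivation_D]

lemmas Dx_rules =
  derivation_0[OF is_field_hom_id is_derivation_Dx]
  derivation_1[OF is_field_hom_id is_derivation_Dx]
  derivation_numeral[OF is_field_hom_id is_derivation_Dx]
  derivation_add[OF is_field_hom_id is_derivation_Dx]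
  derivation_diff[OF is_field_hom_id is_derivation_Dx]
  derivation_uminus[OF is_field_hom_id is_derivation_Dx]
  derivation_mult[OF is_field_hom_id is_derivation_Dx]
  derivation_power2[OF is_field_hom_id is_derivation_Dx]

lemmas Dy_rules =
  derivation_0[OF is_field_hom_id is_derivation_Dy]
  derivation_1[OF is_field_hom_id is_derivation_Dy]
  derivation_numeral[OF is_field_hom_id is_derivation_Dy]
  derivation_add[OF is_field_hom_id is_derivation_Dy]
  derivation_diff[OF is_field_hom_id is_derivation_Dy]
  derivation_uminus[OF is_field_hom_id is_derivation_Dy]
  derivation_mult[OF is_field_hom_id is_derivation_Dy]
  derivation_power2[OF is_field_hom_id is_derivation_Dy]

lemma D_cst [simp]: "D (cst c) = 0"
  and Dx_cst [simp]: "Dx (cst c) = 0"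
  and Dy_cst [simp]: "Dy (cst c) = 0"
  by (simp_all add: D_def Dx_def Dy_def)

lemma D_var [simp]: "D (var (i, k)) = var (i, Suc k)"
  and Dx_var [simp]: "Dx (var (p, i, k)) = (if p then 0 else var (p, i, Suc k))"
  and Dy_var [simp]: "Dy (var (p, i, k)) = (if p then var (p, i, Suc k) else 0)"
  by (simp_all add: D_def Dx_def Dy_def)

lemma is_derivation_comp_hom:
  "is_derivation (\<lambda>f. f) d \<Longrightarrow> is_field_hom h \<Longrightarrow> is_derivation h (\<lambda>f. d (h f))"
  by (auto simp: is_derivation_def is_field_hom_def)

lemma is_derivation_hom_comp:
  "is_derivation (\<lambda>f. f) d \<Longrightarrow> is_field_hom h \<Longrightarrow> is_derivation h (\<lambda>f. h (d f))"
  by (auto simp: is_derivation_def is_field_hom_def)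

text \<open>A composite of two derivations is not a derivation but their commutator is, so
  commutation relations can be tested on variables.\<close>

lemma is_derivation_commutator:
  "is_derivation (\<lambda>f. f) d \<Longrightarrow> is_derivation (\<lambda>f. f) d' \<Longrightarrow>
    is_derivation (\<lambda>f. f) (\<lambda>f. d (d' f) - d' (d f))"
  by (auto simp: is_derivation_def algebra_simps)

lemma is_derivation_zero: "is_derivation h (\<lambda>_. 0)"
  by (simp add: is_derivation_def)

lemma Dx_Dy_commute: "Dx (Dy F) = Dy (Dx F)"
proof -
  have "Dx (Dy F) - Dy (Dx F) = 0"
    by (rule derivation_eqI[OF is_field_hom_id
        is_derivation_commutator[OF is_derivation_Dx is_derivation_Dy] is_derivation_zero])
      (auto simp: Dx_rules Dy_rules)
  then show ?thesis by simp
qed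

text \<open>\<open>diag\<close> is a left inverse of both evaluations. This makes them total
  homomorphisms, while \<open>diag\<close> remains partial.\<close>

lemma at_x_diag: "subst_regular (\<lambda>(p, v). var v) (at_x f)" "diag (at_x f) = f"
  and at_y_diag: "subst_regular (\<lambda>(p, v). var v) (at_y f)" "diag (at_y f) = f"
  and is_field_hom_at_x: "is_field_hom at_x"
  and is_field_hom_at_y: "is_field_hom at_y"
proof -
  have *: "subst_regular (\<lambda>(p, v). var v) (var (q, u)) \<and>
      subst (\<lambda>(p, v). var v) (var (q, u)) = (var u :: onept)" for q :: bool and u :: jet
    by simp
  note inv = subst_left_inverse[where t = "\<lambda>(p, v). var v", OF *]
  show "subst_regular (\<lambda>(p, v). var v) (at_x f)" "diag (at_x f) = f"
    unfolding at_x_def diag_def by (rule inv)+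
  show "subst_regular (\<lambda>(p, v). var v) (at_y f)" "diag (at_y f) = f"
    unfolding at_y_def diag_def by (rule inv)+
  show "is_field_hom at_x" "is_field_hom at_y"
    unfolding at_x_def at_y_def by (intro is_field_hom_subst inv)+
qed

declare at_x_diag(2) [simp] at_y_diag(2) [simp]

lemmas at_x_hom [simp] = field_hom_simps[OF is_field_hom_at_x]
lemmas at_y_hom [simp] = field_hom_simps[OF is_field_hom_at_y]

lemma at_x_cst [simp]: "at_x (cst c) = cst c"
  and at_y_cst [simp]: "at_y (cst c) = cst c"
  and at_x_var [simp]: "at_x (var v) = var (False, v)"
  and at_y_var [simp]: "at_y (var v) = var (True, v)"
  by (simp_all add: at_x_def at_y_def)

lemma Dx_at_x [simp]: "Dx (at_x f) = at_x (D f)"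
  by (rule derivation_eqI[OF is_field_hom_at_x
      is_derivation_comp_hom[OF is_derivation_Dx is_field_hom_at_x]
      is_derivation_hom_comp[OF is_derivation_D is_field_hom_at_x]])
    auto

lemma Dy_at_y [simp]: "Dy (at_y f) = at_y (D f)"
  by (rule derivation_eqI[OF is_field_hom_at_y
      is_derivation_comp_hom[OF is_derivation_Dy is_field_hom_at_y]
      is_derivation_hom_comp[OF is_derivation_D is_field_hom_at_y]])
    auto

lemma Dx_at_y [simp]: "Dx (at_y f) = 0"
  by (rule derivation_eqI[OF is_field_hom_at_y
      is_derivation_comp_hom[OF is_derivation_Dx is_field_hom_at_y]
      is_derivation_zero])
    auto

lemma Dy_at_x [simp]: "Dy (at_x f) = 0"
  by (rule derivation_eqI[OF is_field_hom_at_x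
      is_derivation_comp_hom[OF is_derivation_Dy is_field_hom_at_x]
      is_derivation_zero])
    auto

section \<open>Differential subfields, and two-point functions regular on the diagonal\<close>

lemma diff_subfield_UNIV: "diff_subfield {D} UNIV"
  by (simp add: diff_subfield_def)

lemma diff_subfieldD:
  assumes "diff_subfield Ds K"
  shows "cst c \<in> K"
    and "f \<in> K \<Longrightarrow> g \<in> K \<Longrightarrow> f + g \<in> K"
    and "f \<in> K \<Longrightarrow> g \<in> K \<Longrightarrow> f - g \<in> K"
    and "f \<in> K \<Longrightarrow> g \<in> K \<Longrightarrow> f * g \<in> K"
    and "f \<in> K \<Longrightarrow> g \<in> K \<Longrightarrow> f / g \<in> K"
    and "d \<in> Ds \<Longrightarrow> f \<in> K \<Longrightarrow> d f \<in> K"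
  using assms unfolding diff_subfield_def by blast+

lemma diff_subfield_0: "diff_subfield Ds K \<Longrightarrow> 0 \<in> K"
  and diff_subfield_1: "diff_subfield Ds K \<Longrightarrow> 1 \<in> K"
  and diff_subfield_of_nat: "diff_subfield Ds K \<Longrightarrow> of_nat n \<in> K"
  and diff_subfield_numeral: "diff_subfield Ds K \<Longrightarrow> numeral m \<in> K"
  using diff_subfieldD(1)[of Ds K 0] diff_subfieldD(1)[of Ds K 1]
    diff_subfieldD(1)[of Ds K "of_nat n"] diff_subfieldD(1)[of Ds K "numeral m"]
  by (simp_all add: cst_of_nat cst_numeral)

lemma diff_subfield_uminus: "diff_subfield Ds K \<Longrightarrow> f \<in> K \<Longrightarrow> - f \<in> K"
  using diff_subfieldD(3)[of Ds K 0 f] diff_subfield_0[of Ds K] by simp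

lemma diff_subfield_inverse: "diff_subfield Ds K \<Longrightarrow> f \<in> K \<Longrightarrow> inverse f \<in> K"
  using diff_subfieldD(5)[of Ds K 1 f] diff_subfield_1[of Ds K] by (simp add: divide_inverse)

lemma diff_subfield_power: "diff_subfield Ds K \<Longrightarrow> f \<in> K \<Longrightarrow> f ^ n \<in> K"
  by (induction n) (simp_all add: diff_subfield_1 diff_subfieldD(4))

lemma diff_subfield_sum:
  "diff_subfield Ds K \<Longrightarrow> (\<And>i. i \<in> I \<Longrightarrow> f i \<in> K) \<Longrightarrow> sum f I \<in> K"
  by (induction I rule: infinite_finite_induct) (simp_all add: diff_subfield_0 diff_subfieldD(2))

lemmas diff_subfield_intros = diff_subfieldD diff_subfield_0 diff_subfield_1 diff_subfield_of_nat
  diff_subfield_numeral diff_subfield_uminus diff_subfield_inverse diff_subfield_power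

text \<open>The sums of products at_x f * at_y g with f and g in L; all of them are regular on the diagonal.\<close>
inductive_set tens :: "onept set \<Rightarrow> twopt set" for L where
  tens_at_x: "f \<in> L \<Longrightarrow> at_x f \<in> tens L"
| tens_at_y: "f \<in> L \<Longrightarrow> at_y f \<in> tens L"
| tens_add: "S \<in> tens L \<Longrightarrow> T \<in> tens L \<Longrightarrow> S + T \<in> tens L"
| tens_mult: "S \<in> tens L \<Longrightarrow> T \<in> tens L \<Longrightarrow> S * T \<in> tens L"

lemma tens_mono: "S \<in> tens L \<Longrightarrow> L \<subseteq> L' \<Longrightarrow> S \<in> tens L'"
  by (induction rule: tens.induct) (auto intro: tens.intros)

lemma tens_UNIV: "S \<in> tens L \<Longrightarrow> S \<in> tens UNIV"
  by (rule tens_mono) auto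

lemma tens_regular: "S \<in> tens L \<Longrightarrow> subst_regular (\<lambda>(p, v). var v) S"
  by (induction rule: tens.induct)
    (auto intro: at_x_diag(1) at_y_diag(1) subst_regular_add(1) subst_regular_mult(1))

lemma diag_add: "S \<in> tens UNIV \<Longrightarrow> T \<in> tens UNIV \<Longrightarrow> diag (S + T) = diag S + diag T"
  and diag_mult: "S \<in> tens UNIV \<Longrightarrow> T \<in> tens UNIV \<Longrightarrow> diag (S * T) = diag S * diag T"
  by (simp_all add: diag_def subst_regular_add subst_regular_mult tens_regular)

lemma diag_cst [simp]: "diag (cst c) = cst c"
  by (simp add: diag_def)

lemma diag_0 [simp]: "diag 0 = 0" and diag_1 [simp]: "diag 1 = 1"
  and diag_numeral [simp]: "diag (numeral n) = numeral n"
  using diag_cst[of 0] diag_cst[of 1] diag_cst[of "numeral n"] by (simp_all add: cst_numeral)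

context
  fixes L assumes L: "diff_subfield {D} L"
begin

lemma tens_cst: "cst c \<in> tens L"
  using tens_at_x[of "cst c" L] diff_subfieldD(1)[OF L] by simp

lemma tens_0: "0 \<in> tens L" and tens_1: "1 \<in> tens L" and tens_numeral: "numeral n \<in> tens L"
  using tens_cst[of 0] tens_cst[of 1] tens_cst[of "numeral n"] by (simp_all add: cst_numeral)

lemma tens_uminus: "S \<in> tens L \<Longrightarrow> - S \<in> tens L"
  using tens_mult[OF tens_cst[of "-1"], of S] by (simp add: cst_uminus)

lemma tens_diff: "S \<in> tens L \<Longrightarrow> T \<in> tens L \<Longrightarrow> S - T \<in> tens L"
  using tens_add[of S L "- T"] tens_uminus[of T] by simp

lemma tens_power: "S \<in> tens L \<Longrightarrow> S ^ n \<in> tens L"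
  by (induction n) (simp_all add: tens_1 tens_mult)

lemma tens_Dx: "S \<in> tens L \<Longrightarrow> Dx S \<in> tens L"
  by (induction rule: tens.induct)
    (auto simp: Dx_rules intro: tens.intros tens_0 diff_subfieldD(6)[OF L])

lemma tens_Dy: "S \<in> tens L \<Longrightarrow> Dy S \<in> tens L"
  by (induction rule: tens.induct)
    (auto simp: Dy_rules intro: tens.intros tens_0 diff_subfieldD(6)[OF L])

lemma diag_tens: "S \<in> tens L \<Longrightarrow> diag S \<in> L"
proof (induction rule: tens.induct)
  case (tens_add S T)
  then show ?case by (simp add: diag_add[OF tens_UNIV tens_UNIV] diff_subfieldD(2)[OF L])
next
  case (tens_mult S T)
  then show ?case by (simp add: diag_mult[OF tens_UNIV tens_UNIV] diff_subfieldD(4)[OF L])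
qed simp_all

end

lemmas tens_UNIV_simps [simp] = tens_at_x[OF UNIV_I] tens_at_y[OF UNIV_I]
  tens_add[where L = UNIV] tens_mult[where L = UNIV]
  tens_cst[OF diff_subfield_UNIV] tens_0[OF diff_subfield_UNIV] tens_1[OF diff_subfield_UNIV]
  tens_numeral[OF diff_subfield_UNIV] tens_uminus[OF diff_subfield_UNIV]
  tens_diff[OF diff_subfield_UNIV] tens_power[OF diff_subfield_UNIV]
  tens_Dx[OF diff_subfield_UNIV] tens_Dy[OF diff_subfield_UNIV]

lemma diag_uminus: "S \<in> tens UNIV \<Longrightarrow> diag (- S) = - diag S"
  using diag_add[of S "- S"] by (simp add: eq_neg_iff_add_eq_0 add.commute)

lemma diag_diff: "S \<in> tens UNIV \<Longrightarrow> T \<in> tens UNIV \<Longrightarrow> diag (S - T) = diag S - diag T"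
  using diag_add[of S "- T"] by (simp add: diag_uminus)

lemma diag_power: "S \<in> tens UNIV \<Longrightarrow> diag (S ^ n) = diag S ^ n"
  by (induction n) (simp_all add: diag_mult)

lemmas diag_simps [simp] = diag_add diag_mult diag_uminus diag_diff diag_power

text \<open>The chain rule on x = y: moving the common point moves both arguments.\<close>

lemma D_diag: "S \<in> tens UNIV \<Longrightarrow> D (diag S) = diag (Dx S) + diag (Dy S)"
  by (induction rule: tens.induct) (simp_all add: Dx_rules Dy_rules D_rules algebra_simps)


section \<open>Kernels\<close>

definition scale_delta :: "twopt \<Rightarrow> onept poly \<Rightarrow> onept poly" where
  "scale_delta f Q = (\<Sum>k\<le>Polynomial.degree Q. \<Sum>j\<le>k.
     monom (of_nat (k choose j) * diag ((Dy ^^ j) f) * Polynomial.coeff Q k) (k - j))"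

lemma kscale_eq: "f \<odot> (A, P, S, Q) = (f * A, Polynomial.smult f P, f * S, scale_delta f Q)"
  by (simp add: scale_delta_def)

lemma scale_delta_superset:
  assumes "Polynomial.degree Q \<le> n"
  shows "scale_delta f Q = (\<Sum>k\<le>n. \<Sum>j\<le>k.
     monom (of_nat (k choose j) * diag ((Dy ^^ j) f) * Polynomial.coeff Q k) (k - j))"
  unfolding scale_delta_def
  by (rule sum.mono_neutral_left) (use assms in \<open>auto simp: coeff_eq_0\<close>)

lemma scale_delta_0 [simp]: "scale_delta f 0 = 0"
  by (simp add: scale_delta_def)

text \<open>This is the identity f delta^(k+1) = -(d/dy)(f delta^(k)) + (df/dy) delta^(k), where
  -d/dy acts as \<open>pCons 0\<close> because coefficients are kept at x. It replaces the double
  binomial sum in later inductions, where \<open>f\<close> must vary since it turns into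
  \<open>Dy f\<close>.\<close>

lemma scale_delta_pCons:
  "scale_delta f (pCons c Q) =
    [:diag f * c:] + pCons 0 (scale_delta f Q) + scale_delta (Dy f) Q"
proof -
  define n where "n = Polynomial.degree Q"
  define d where "d j = diag ((Dy ^^ j) f)" for j
  define q where "q = Polynomial.coeff Q"
  have pm: "pCons 0 (monom a m) = monom a (Suc m)" for a :: onept and m
    by (simp add: monom_Suc)
  have shift: "pCons 0 (\<Sum>i\<in>I. g i) = (\<Sum>i\<in>I. pCons 0 (g i))" for g :: "nat \<Rightarrow> onept poly" and I
    by (induction I rule: infinite_finite_induct) (simp_all, metis add_pCons add.right_neutral)
  \<comment> \<open>Pascal's rule for the terms with j > 0. The half with
    \<open>k choose Suc j\<close> joins the j = 0 term to form the first sum.\<close>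
  have step: "(\<Sum>j\<le>Suc k. monom (of_nat (Suc k choose j) * d j * q k) (Suc k - j)) =
      (\<Sum>j\<le>k. monom (of_nat (k choose j) * d j * q k) (Suc (k - j))) +
      (\<Sum>j\<le>k. monom (of_nat (k choose j) * d (Suc j) * q k) (k - j))" for k
  proof -
    have "(\<Sum>j\<le>Suc k. monom (of_nat (Suc k choose j) * d j * q k) (Suc k - j)) =
        monom (d 0 * q k) (Suc k) +
        (\<Sum>j\<le>k. monom (of_nat (k choose j) * d (Suc j) * q k) (k - j)) +
        (\<Sum>j\<le>k. monom (of_nat (k choose Suc j) * d (Suc j) * q k) (k - j))"
      by (simp add: sum.atMost_Suc_shift sum.distrib add_monom[symmetric] algebra_simps del: sum.atMost_Suc)
    moreover have "(\<Sum>j\<le>k. monom (of_nat (k choose j) * d j * q k) (Suc (k - j))) =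
        monom (d 0 * q k) (Suc k) +
        (\<Sum>j\<le>k. monom (of_nat (k choose Suc j) * d (Suc j) * q k) (k - j))"
    proof -
      \<comment> \<open>The added term j = \<open>Suc k\<close> has binomial coefficient 0; with it
        the sum can be split off at j = 0.\<close>
      have "(\<Sum>j\<le>k. monom (of_nat (k choose j) * d j * q k) (Suc (k - j))) =
          (\<Sum>j\<le>Suc k. monom (of_nat (k choose j) * d j * q k) (Suc k - j))"
        by (simp add: Suc_diff_le binomial_eq_0)
      then show ?thesis
        by (simp add: sum.atMost_Suc_shift del: sum.atMost_Suc)
    qed
    ultimately show ?thesis by (simp add: algebra_simps)
  qed
  have "scale_delta f (pCons c Q) = (\<Sum>k\<le>Suc n. \<Sum>j\<le>k.
     monom (of_nat (k choose j) * d j * Polynomial.coeff (pCons c Q) k) (k - j))"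
    unfolding d_def by (rule scale_delta_superset) (simp add: n_def degree_pCons_le)
  also have "\<dots> = monom (d 0 * c) 0 + (\<Sum>k\<le>n. \<Sum>j\<le>Suc k.
     monom (of_nat (Suc k choose j) * d j * q k) (Suc k - j))"
    by (simp add: sum.atMost_Suc_shift q_def del: sum.atMost_Suc)
  also have "\<dots> = monom (d 0 * c) 0 +
      (\<Sum>k\<le>n. \<Sum>j\<le>k. monom (of_nat (k choose j) * d j * q k) (Suc (k - j))) +
      (\<Sum>k\<le>n. \<Sum>j\<le>k. monom (of_nat (k choose j) * d (Suc j) * q k) (k - j))"
    by (simp add: step sum.distrib add.assoc del: sum.atMost_Suc)
  also have "(\<Sum>k\<le>n. \<Sum>j\<le>k. monom (of_nat (k choose j) * d j * q k) (Suc (k - j))) =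
      pCons 0 (scale_delta f Q)"
    by (simp add: scale_delta_def shift pm d_def q_def n_def)
  also have "(\<Sum>k\<le>n. \<Sum>j\<le>k. monom (of_nat (k choose j) * d (Suc j) * q k) (k - j)) =
      scale_delta (Dy f) Q"
    by (simp add: scale_delta_def d_def q_def n_def funpow_swap1)
  finally show ?thesis by (simp add: monom_0 d_def)
qed

lemma scale_delta_add_right: "scale_delta f (Q + R) = scale_delta f Q + scale_delta f R"
  by (induction Q R arbitrary: f rule: poly_induct2)
    (simp_all add: scale_delta_pCons algebra_simps)

lemma scale_delta_uminus_right: "scale_delta f (- Q) = - scale_delta f Q"
  by (induction Q arbitrary: f) (simp_all add: scale_delta_pCons)

lemma scale_delta_diff_right: "scale_delta f (Q - R) = scale_delta f Q - scale_delta f R"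
  using scale_delta_add_right[of f Q "- R"] by (simp add: scale_delta_uminus_right)

lemma scale_delta_add_left:
  "f \<in> tens UNIV \<Longrightarrow> g \<in> tens UNIV \<Longrightarrow> scale_delta (f + g) Q = scale_delta f Q + scale_delta g Q"
  by (induction Q arbitrary: f g) (simp_all add: scale_delta_pCons Dy_rules algebra_simps)

lemma scale_delta_mult:
  "f \<in> tens UNIV \<Longrightarrow> g \<in> tens UNIV \<Longrightarrow> scale_delta (f * g) Q = scale_delta f (scale_delta g Q)"
proof (induction Q arbitrary: f g)
  case (pCons c Q)
  have "scale_delta (Dy (f * g)) Q =
      scale_delta (Dy f) (scale_delta g Q) + scale_delta f (scale_delta (Dy g) Q)"
    using pCons by (simp add: Dy_rules scale_delta_add_left)
  then show ?case
    using pCons by (simp add: scale_delta_pCons scale_delta_add_right)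
qed simp

lemma scale_delta_zero [simp]: "scale_delta 0 Q = 0"
  by (induction Q) (simp_all add: scale_delta_pCons Dy_rules)

lemma scale_delta_one [simp]: "scale_delta 1 Q = Q"
  by (induction Q) (simp_all add: scale_delta_pCons Dy_rules)

text \<open>Coefficients of delta are kept at x, so a function of x alone multiplies them without
  correction terms.\<close>

lemma scale_delta_at_x [simp]: "scale_delta (at_x f) Q = Polynomial.smult f Q"
  by (induction Q) (simp_all add: scale_delta_pCons)

lemma map_poly_add_hom:
  assumes "d 0 = 0" "\<And>f g. d (f + g) = d f + d g"
  shows "map_poly d (P + Q) = map_poly d P + map_poly d Q"
  by (intro poly_eqI) (simp add: coeff_map_poly assms)

lemma map_poly_pCons_0: "d 0 = 0 \<Longrightarrow> map_poly d (pCons c Q) = pCons (d c) (map_poly d Q)"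
  by (simp add: map_poly_pCons)

lemma map_D_add: "map_poly D (P + Q) = map_poly D P + map_poly D Q"
  and map_Dx_add: "map_poly Dx (R + T) = map_poly Dx R + map_poly Dx T"
  and map_Dy_add: "map_poly Dy (R + T) = map_poly Dy R + map_poly Dy T"
  by (simp_all add: map_poly_add_hom D_rules Dx_rules Dy_rules)

lemma map_Dx_smult:
  "map_poly Dx (Polynomial.smult f P) = Polynomial.smult (Dx f) P + Polynomial.smult f (map_poly Dx P)"
  and map_Dy_smult:
  "map_poly Dy (Polynomial.smult f P) = Polynomial.smult (Dy f) P + Polynomial.smult f (map_poly Dy P)"
  by (intro poly_eqI; simp add: coeff_map_poly Dx_rules Dy_rules)+

lemma map_D_scale_delta:
  "f \<in> tens UNIV \<Longrightarrow> map_poly D (scale_delta f Q) =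
    scale_delta (Dx f) Q + scale_delta (Dy f) Q + scale_delta f (map_poly D Q)"
proof (induction Q arbitrary: f)
  case (pCons c Q)
  then show ?case
    by (simp add: scale_delta_pCons map_D_add map_poly_pCons_0 D_rules D_diag Dx_Dy_commute algebra_simps)
qed simp

text \<open>Only the sign coefficient is constrained: \<open>kdx\<close> and \<open>kdy\<close>
  restrict it to the diagonal to produce delta terms, whereas the function part and the coefficients
  of a^(k) are never restricted.\<close>

definition regular_ker :: "kernel \<Rightarrow> bool" where
  "regular_ker K \<longleftrightarrow> fst (snd (snd K)) \<in> tens UNIV"

lemma regular_ker_tuple [simp]: "regular_ker (A, P, S, Q) \<longleftrightarrow> S \<in> tens UNIV"
  by (simp add: regular_ker_def)

lemma regular_ker_0 [simp]: "regular_ker 0"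
  and regular_ker_add [simp]: "regular_ker K \<Longrightarrow> regular_ker K' \<Longrightarrow> regular_ker (K + K')"
  by (simp_all add: regular_ker_def)

lemma regular_ker_kscale [simp]: "f \<in> tens UNIV \<Longrightarrow> regular_ker K \<Longrightarrow> regular_ker (f \<odot> K)"
  and regular_ker_kdx [simp]: "regular_ker K \<Longrightarrow> regular_ker (kdx K)"
  and regular_ker_kdy [simp]: "regular_ker K \<Longrightarrow> regular_ker (kdy K)"
  by (cases K; simp)+

lemma regular_ker_sum [simp]: "(\<And>i. i \<in> I \<Longrightarrow> regular_ker (k i)) \<Longrightarrow> regular_ker (sum k I)"
  by (induction I rule: infinite_finite_induct) auto

lemma regular_ker_funpow_kdx [simp]: "regular_ker K \<Longrightarrow> regular_ker ((kdx ^^ n) K)"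
  and regular_ker_funpow_kdy [simp]: "regular_ker K \<Longrightarrow> regular_ker ((kdy ^^ n) K)"
  by (induction n) simp_all

declare kscale.simps [simp del]

lemma zero_kernel: "(0::kernel) = (0, 0, 0, 0)"
  by (simp add: zero_prod_def)

lemma kscale_add_right: "f \<odot> (K + K') = f \<odot> K + f \<odot> K'"
  by (cases K; cases K') (simp add: kscale_eq scale_delta_add_right algebra_simps smult_add_right)

lemma kscale_add_left:
  "f \<in> tens UNIV \<Longrightarrow> g \<in> tens UNIV \<Longrightarrow> (f + g) \<odot> K = f \<odot> K + g \<odot> K"
  by (cases K) (simp add: kscale_eq scale_delta_add_left algebra_simps smult_add_left)

lemma kscale_mult:
  "f \<in> tens UNIV \<Longrightarrow> g \<in> tens UNIV \<Longrightarrow> (f * g) \<odot> K = f \<odot> (g \<odot> K)"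
  by (cases K) (simp add: kscale_eq scale_delta_mult algebra_simps)

lemma kscale_0_left [simp]: "0 \<odot> K = 0"
  and kscale_1 [simp]: "1 \<odot> K = K"
  by (cases K; simp add: kscale_eq zero_kernel)+

lemma kscale_0_right [simp]: "f \<odot> 0 = 0"
  by (simp add: zero_kernel kscale_eq)

lemma kscale_sum_right: "f \<odot> (\<Sum>i\<in>I. k i) = (\<Sum>i\<in>I. f \<odot> k i)"
  by (induction I rule: infinite_finite_induct) (simp_all add: kscale_add_right)

lemma kdx_0 [simp]: "kdx 0 = 0" and kdy_0 [simp]: "kdy 0 = 0"
  by (simp_all add: zero_kernel Dx_rules Dy_rules)

lemma kdx_add: "regular_ker K \<Longrightarrow> regular_ker K' \<Longrightarrow> kdx (K + K') = kdx K + kdx K'"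
  by (cases K; cases K') (simp add: Dx_rules map_Dx_add map_D_add algebra_simps)

lemma kdy_add: "regular_ker K \<Longrightarrow> regular_ker K' \<Longrightarrow> kdy (K + K') = kdy K + kdy K'"
  by (cases K; cases K') (simp add: Dy_rules map_Dy_add algebra_simps)

lemma kdx_sum: "(\<And>i. i \<in> I \<Longrightarrow> regular_ker (k i)) \<Longrightarrow> kdx (\<Sum>i\<in>I. k i) = (\<Sum>i\<in>I. kdx (k i))"
  by (induction I rule: infinite_finite_induct) (simp_all add: kdx_add)

lemma kdy_sum: "(\<And>i. i \<in> I \<Longrightarrow> regular_ker (k i)) \<Longrightarrow> kdy (\<Sum>i\<in>I. k i) = (\<Sum>i\<in>I. kdy (k i))"
  by (induction I rule: infinite_finite_induct) (simp_all add: kdy_add)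

text \<open>By \<open>map_D_scale_delta\<close>, differentiating the restricted coefficients yields
  an additional term \<open>scale_delta (Dy f) Q\<close>. It is exactly the term that
  \<open>scale_delta_pCons\<close> needs to carry \<open>pCons 0\<close> past
  \<open>f\<close>.\<close>

lemma kdx_kscale:
  "f \<in> tens UNIV \<Longrightarrow> regular_ker K \<Longrightarrow> kdx (f \<odot> K) = Dx f \<odot> K + f \<odot> kdx K"
  by (cases K) (simp add: kscale_eq Dx_rules map_Dx_smult map_D_scale_delta scale_delta_add_right
      scale_delta_pCons algebra_simps smult_add_right)

text \<open>The delta coefficients sit at x and are not differentiated here; on the delta part,
  \<open>Dy f\<close> comes from the recursion \<open>scale_delta_pCons\<close> alone.\<close>

lemma kdy_kscale:
  assumes "f \<in> tens UNIV" "regular_ker K"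
  shows "kdy (f \<odot> K) = Dy f \<odot> K + f \<odot> kdy K"
proof (cases K)
  case (fields A P S Q)
  have S: "S \<in> tens UNIV" using assms fields by simp
  have "map_poly Dy (Polynomial.smult f P) - pCons 0 (Polynomial.smult f P) =
      Polynomial.smult (Dy f) P + Polynomial.smult f (map_poly Dy P - pCons 0 P)"
    by (simp add: map_Dy_smult smult_diff_right)
  moreover have "- pCons 0 (scale_delta f Q) - [:2 * diag (f * S):] =
      scale_delta (Dy f) Q + scale_delta f (- pCons 0 Q - [:2 * diag S:])"
    using assms S
    by (simp add: scale_delta_diff_right scale_delta_uminus_right scale_delta_pCons mult.left_commute)
  ultimately show ?thesis
    by (simp add: fields kscale_eq Dy_rules)
qed

text \<open>The delta terms created from sign(x-y) agree in the two orders by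
  \<open>D_diag\<close>.\<close>

lemma kdx_kdy_commute:
  assumes "regular_ker K"
  shows "kdx (kdy K) = kdy (kdx K)"
proof (cases K)
  case (fields A P S Q)
  have S: "S \<in> tens UNIV" using assms fields by simp
  have "map_poly Dx (map_poly Dy P - pCons 0 P) + pCons 0 (map_poly Dy P - pCons 0 P) =
      map_poly Dy (map_poly Dx P + pCons 0 P) - pCons 0 (map_poly Dx P + pCons 0 P)"
    by (rule poly_eqI)
      (simp add: coeff_map_poly coeff_pCons Dx_rules Dy_rules Dx_Dy_commute split: nat.split)
  moreover have "map_poly D (- pCons 0 Q - [:2 * diag S:]) + pCons 0 (- pCons 0 Q - [:2 * diag S:]) +
        [:2 * diag (Dy S):] =
      - pCons 0 (map_poly D Q + pCons 0 Q + [:2 * diag S:]) - [:2 * diag (Dx S):]"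
    by (rule poly_eqI)
      (simp add: coeff_map_poly coeff_pCons D_rules D_diag[OF S] algebra_simps split: nat.split)
  ultimately show ?thesis
    by (simp add: fields Dx_Dy_commute)
qed

section \<open>The bracket as a biderivation\<close>

text \<open>Extension of Z along one argument by the chain rule; e is at_x or at_y.\<close>
definition chain_sum :: "(onept \<Rightarrow> twopt) \<Rightarrow> (jet \<Rightarrow> kernel) \<Rightarrow> onept \<Rightarrow> kernel" where
  "chain_sum e Z F = (\<Sum>u | pdiff u F \<noteq> 0. e (pdiff u F) \<odot> Z u)"

lemma var_neq_0 [simp]: "var v \<noteq> 0"
  using pdiff_var[of v v] pdiff_cst[of v 0] by (auto simp del: pdiff_cst)

text \<open>The commutator of the partial derivative by the l-th jet with D is the partial
  derivative by the (l-1)-st jet, and zero for l = 0.\<close>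

lemma pdiff_D:
  "pdiff (j, l) (D F) = D (pdiff (j, l) F) + (case l of 0 \<Rightarrow> 0 | Suc l' \<Rightarrow> pdiff (j, l') F)"
proof -
  let ?d = "\<lambda>F. case l of 0 \<Rightarrow> 0 | Suc l' \<Rightarrow> pdiff (j, l') F"
  have der: "is_derivation (\<lambda>f. f) ?d"
    by (cases l) (simp_all add: is_derivation_zero is_derivation_pdiff)
  have "pdiff (j, l) (D F) - D (pdiff (j, l) F) = ?d F"
    by (rule derivation_eqI[OF is_field_hom_id
          is_derivation_commutator[OF is_derivation_pdiff is_derivation_D] der])
      (auto simp: pdiff_var D_rules split: nat.split
        simp flip: cst_0 cst_1)
  then show ?thesis by (simp add: algebra_simps)
qed

text \<open>Instantiated with \<open>at_x\<close> and with \<open>at_y\<close>, so that the two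
  arguments of the bracket share one development.\<close>

locale chain =
  fixes e :: "onept \<Rightarrow> twopt"
  assumes hom: "is_field_hom e" and in_tens [simp]: "e f \<in> tens UNIV"
begin

lemma chain_sum_superset:
  assumes "finite U" "{u. pdiff u F \<noteq> 0} \<subseteq> U"
  shows "chain_sum e Z F = (\<Sum>u\<in>U. e (pdiff u F) \<odot> Z u)"
  unfolding chain_sum_def
  by (rule sum.mono_neutral_left) (use assms in \<open>auto simp: field_hom_0[OF hom]\<close>)

lemma chain_sum_add: "chain_sum e Z (F + G) = chain_sum e Z F + chain_sum e Z G"
proof -
  let ?U = "{v. pdiff v F \<noteq> 0} \<union> {v. pdiff v G \<noteq> 0}"
  have fin: "finite ?U" by (simp add: finite_pdiff)
  have "chain_sum e Z (F + G) = (\<Sum>u\<in>?U. e (pdiff u (F + G)) \<odot> Z u)"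
    by (rule chain_sum_superset[OF fin]) (auto simp: pdiff_add)
  then show ?thesis
    by (simp add: chain_sum_superset[OF fin] pdiff_add field_hom_add[OF hom] kscale_add_left
      sum.distrib)
qed

lemma chain_sum_mult:
  "chain_sum e Z (F * G) = e F \<odot> chain_sum e Z G + e G \<odot> chain_sum e Z F"
proof -
  let ?U = "{v. pdiff v F \<noteq> 0} \<union> {v. pdiff v G \<noteq> 0}"
  have fin: "finite ?U" by (simp add: finite_pdiff)
  have "chain_sum e Z (F * G) = (\<Sum>u\<in>?U. e (pdiff u (F * G)) \<odot> Z u)"
    by (rule chain_sum_superset[OF fin]) (auto simp: pdiff_mult)
  also have "\<dots> = (\<Sum>u\<in>?U. e F \<odot> (e (pdiff u G) \<odot> Z u) + e G \<odot> (e (pdiff u F) \<odot> Z u))"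
    by (simp add: pdiff_mult field_hom_add[OF hom] field_hom_mult[OF hom] kscale_add_left
      kscale_mult[symmetric] mult.commute add.commute)
  finally show ?thesis
    by (simp add: chain_sum_superset[OF fin] kscale_sum_right sum.distrib)
qed

lemma chain_sum_cst [simp]: "chain_sum e Z (cst c) = 0"
  by (simp add: chain_sum_def)

lemma chain_sum_var [simp]: "chain_sum e Z (var v) = Z v"
proof -
  have "chain_sum e Z (var v) = (\<Sum>u\<in>{v}. e (pdiff u (var v)) \<odot> Z u)"
    by (rule chain_sum_superset) (auto simp: pdiff_var)
  then show ?thesis by (simp add: pdiff_var field_hom_1[OF hom])
qed

text \<open>Solve the product rule for f = (f/g) g. The scalings stay nested so that each multiplier
  is the value of a one-point function at one point, hence regular on the diagonal.\<close>

lemma chain_sum_divide: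
  assumes "g \<noteq> 0"
  shows "chain_sum e Z (f / g) =
    e (1 / g) \<odot> (chain_sum e Z f + e (- (f / g)) \<odot> chain_sum e Z g)"
proof -
  have "chain_sum e Z f = chain_sum e Z ((f / g) * g)" using assms by simp
  also have "\<dots> = e (f / g) \<odot> chain_sum e Z g + e g \<odot> chain_sum e Z (f / g)"
    by (rule chain_sum_mult)
  also have "\<dots> + e (- (f / g)) \<odot> chain_sum e Z g =
      (e (f / g) + e (- (f / g))) \<odot> chain_sum e Z g + e g \<odot> chain_sum e Z (f / g)"
    by (simp add: kscale_add_left)
  also have "\<dots> = e g \<odot> chain_sum e Z (f / g)"
    by (simp add: field_hom_add[OF hom, symmetric] field_hom_0[OF hom])
  finally have "e (1 / g) \<odot> (chain_sum e Z f + e (- (f / g)) \<odot> chain_sum e Z g) =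
      (e (1 / g) * e g) \<odot> chain_sum e Z (f / g)"
    by (simp add: kscale_mult)
  also have "e (1 / g) * e g = 1"
    using assms by (simp add: field_hom_mult[OF hom, symmetric] field_hom_1[OF hom])
  finally show ?thesis by simp
qed

lemma regular_ker_chain_sum:
  "(\<And>u. regular_ker (Z u)) \<Longrightarrow> regular_ker (chain_sum e Z F)"
  unfolding chain_sum_def by auto

text \<open>By \<open>pdiff_D\<close> the sum for \<open>D F\<close> splits in two: the partial
  derivatives of \<open>F\<close> get differentiated, or the jet index is raised. Raising the index
  amounts to applying \<open>kd\<close> to \<open>Z\<close>, so the two halves form the Leibniz rule
  for \<open>kd\<close> term by term.\<close>

lemma chain_sum_D:
  assumes add: "\<And>K K'. regular_ker K \<Longrightarrow> regular_ker K' \<Longrightarrow> kd (K + K') = kd K + kd K'"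
    and kd0: "kd 0 = 0"
    and scale: "\<And>f K. regular_ker K \<Longrightarrow> kd (e f \<odot> K) = e (D f) \<odot> K + e f \<odot> kd K"
    and Z: "\<And>i k. Z (i, Suc k) = kd (Z (i, k))" and reg: "\<And>u. regular_ker (Z u)"
  shows "chain_sum e Z (D F) = kd (chain_sum e Z F)"
proof -
  let ?J = "{u. pdiff u F \<noteq> 0}"
  let ?s = "\<lambda>(i, k). (i, Suc k) :: jet"
  let ?U = "?J \<union> ?s ` ?J"
  let ?p = "\<lambda>(j, l). case l of 0 \<Rightarrow> 0 | Suc l' \<Rightarrow> pdiff (j, l') F"
  have fin: "finite ?J" by (rule finite_pdiff)
  have kd_sum: "kd (\<Sum>i\<in>I. k i) = (\<Sum>i\<in>I. kd (k i))" if "\<And>i. regular_ker (k i)"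
    for k :: "jet \<Rightarrow> kernel" and I
    using that by (induction I rule: infinite_finite_induct) (simp_all add: kd0 add)
  have pD: "pdiff u (D F) = D (pdiff u F) + ?p u" for u
    by (cases u) (simp add: pdiff_D)
  have p: "u \<in> ?s ` ?J" if "?p u \<noteq> 0" for u
  proof -
    obtain j l where u: "u = (j, l)" by fastforce
    with that obtain l' where l: "l = Suc l'" by (cases l) auto
    show ?thesis using that by (intro image_eqI[of _ _ "(j, l')"]) (simp_all add: u l)
  qed
  have "u \<in> ?U" if "pdiff u (D F) \<noteq> 0" for u
    using that p[of u] by (cases "pdiff u F = 0") (simp_all add: pD D_rules)
  then have "chain_sum e Z (D F) = (\<Sum>u\<in>?U. e (pdiff u (D F)) \<odot> Z u)"
    using fin by (intro chain_sum_superset) auto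
  also have "\<dots> = (\<Sum>u\<in>?U. e (D (pdiff u F)) \<odot> Z u) + (\<Sum>u\<in>?U. e (?p u) \<odot> Z u)"
    by (simp only: pD field_hom_add[OF hom] kscale_add_left[OF in_tens in_tens] sum.distrib)
  also have "(\<Sum>u\<in>?U. e (D (pdiff u F)) \<odot> Z u) = (\<Sum>u\<in>?J. e (D (pdiff u F)) \<odot> Z u)"
    by (rule sum.mono_neutral_right) (use fin in \<open>auto simp: D_rules field_hom_0[OF hom]\<close>)
  also have "(\<Sum>u\<in>?U. e (?p u) \<odot> Z u) = (\<Sum>u\<in>?s ` ?J. e (?p u) \<odot> Z u)"
  proof (rule sum.mono_neutral_right)
    show "\<forall>u\<in>?U - ?s ` ?J. e (?p u) \<odot> Z u = 0"
    proof
      fix u assume "u \<in> ?U - ?s ` ?J"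
      then have "?p u = 0" using p[of u] by blast
      then show "e (?p u) \<odot> Z u = 0" by (simp only: field_hom_0[OF hom] kscale_0_left)
    qed
  qed (use fin in auto)
  \<comment> \<open>The shift of the jet index is injective, so the sum can be pulled back along
    it.\<close>
  also have "\<dots> = (\<Sum>u\<in>?J. e (pdiff u F) \<odot> kd (Z u))"
    by (subst sum.reindex) (auto simp: inj_on_def case_prod_unfold Z intro!: sum.cong)
  also have "(\<Sum>u\<in>?J. e (D (pdiff u F)) \<odot> Z u) + (\<Sum>u\<in>?J. e (pdiff u F) \<odot> kd (Z u)) =
      (\<Sum>u\<in>?J. kd (e (pdiff u F) \<odot> Z u))"
    by (simp add: scale reg sum.distrib)
  also have "\<dots> = kd (chain_sum e Z F)"
    by (simp add: chain_sum_def kd_sum reg)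
  finally show ?thesis .
qed

end

interpretation chain_x: chain at_x
  by standard (simp_all add: is_field_hom_at_x)

interpretation chain_y: chain at_y
  by standard (simp_all add: is_field_hom_at_y)

definition jet_bracket :: "jet \<Rightarrow> jet \<Rightarrow> kernel" where
  "jet_bracket u v = (kdx ^^ snd u) ((kdy ^^ snd v) (w_bracket (fst u) (fst v)))"

lemma tens_var [simp]: "var (p, u) \<in> tens UNIV"
  using tens_at_x[of "var u" UNIV] tens_at_y[of "var u" UNIV] by (cases p) auto

lemma regular_ker_w_bracket: "regular_ker (w_bracket k l)"
proof -
  have "regular_ker (R_mat I J)" for I J
    by (simp add: R_mat_def a_ker_def sign_ker_def fun_ker_def kscale_eq)
  then show ?thesis unfolding w_bracket_def
    by (intro regular_ker_sum regular_ker_kscale) simp_all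
qed

lemma regular_ker_jet_bracket: "regular_ker (jet_bracket u v)"
  unfolding jet_bracket_def by (intro regular_ker_funpow_kdx regular_ker_funpow_kdy regular_ker_w_bracket)

lemma kdx_funpow_kdy_commute: "regular_ker K \<Longrightarrow> kdy ((kdx ^^ n) K) = (kdx ^^ n) (kdy K)"
  by (induction n) (simp_all add: kdx_kdy_commute[symmetric])

lemma jet_bracket_Suc_left: "jet_bracket (i, Suc k) v = kdx (jet_bracket (i, k) v)"
  by (simp add: jet_bracket_def)

lemma jet_bracket_Suc_right: "jet_bracket u (j, Suc l) = kdy (jet_bracket u (j, l))"
  by (simp add: jet_bracket_def kdx_funpow_kdy_commute regular_ker_w_bracket)

text \<open>In this form the derivation property in the left argument is inherited from
  \<open>chain_sum\<close>, whatever the inner sum is.\<close>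

lemma bracket_chain_left:
  "bracket F G = chain_sum at_x (\<lambda>u. chain_sum at_y (jet_bracket u) G) F"
proof -
  have "{(i, k). pdiff (i, k) F \<noteq> 0} = {u. pdiff u F \<noteq> 0}" for F :: onept
    by auto
  then show ?thesis
    unfolding bracket_def chain_sum_def jet_bracket_def kscale_sum_right
    by (simp add: kscale_mult case_prod_unfold)
qed

text \<open>The two sums may be exchanged because multiplications by functions of x and by functions
  of y commute on kernels. This gives the derivation property in the right argument.\<close>

lemma bracket_chain_right:
  "bracket F G = chain_sum at_y (\<lambda>v. chain_sum at_x (\<lambda>u. jet_bracket u v) F) G"
  unfolding bracket_chain_left chain_sum_def kscale_sum_right
  by (subst sum.swap) (simp add: kscale_mult[symmetric] mult.commute)

lemma regular_ker_bracket [simp]: "regular_ker (bracket F G)"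
  unfolding bracket_chain_left
  by (intro chain_x.regular_ker_chain_sum chain_y.regular_ker_chain_sum regular_ker_jet_bracket)

lemma bracket_add_left: "bracket (F + F') G = bracket F G + bracket F' G"
  by (simp add: bracket_chain_left chain_x.chain_sum_add)

lemma bracket_add_right: "bracket F (G + G') = bracket F G + bracket F G'"
  by (simp add: bracket_chain_right chain_y.chain_sum_add)

lemma bracket_mult_left: "bracket (F * F') G = at_x F \<odot> bracket F' G + at_x F' \<odot> bracket F G"
  by (simp add: bracket_chain_left chain_x.chain_sum_mult)

lemma bracket_mult_right: "bracket F (G * G') = at_y G \<odot> bracket F G' + at_y G' \<odot> bracket F G"
  by (simp add: bracket_chain_right chain_y.chain_sum_mult)

lemma bracket_cst_left [simp]: "bracket (cst c) G = 0"
  by (simp add: bracket_chain_left)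

lemma bracket_cst_right [simp]: "bracket F (cst c) = 0"
  by (simp add: bracket_chain_right)

lemma bracket_divide_left:
  "F' \<noteq> 0 \<Longrightarrow> bracket (F / F') G =
    at_x (1 / F') \<odot> (bracket F G + at_x (- (F / F')) \<odot> bracket F' G)"
  unfolding bracket_chain_left by (rule chain_x.chain_sum_divide)

lemma bracket_divide_right:
  "G' \<noteq> 0 \<Longrightarrow> bracket F (G / G') =
    at_y (1 / G') \<odot> (bracket F G + at_y (- (G / G')) \<odot> bracket F G')"
  unfolding bracket_chain_right by (rule chain_y.chain_sum_divide)

lemma bracket_D_left: "bracket (D F) G = kdx (bracket F G)"
  unfolding bracket_chain_left
proof (rule chain_x.chain_sum_D)
  show "chain_sum at_y (jet_bracket (i, Suc k)) G = kdx (chain_sum at_y (jet_bracket (i, k)) G)" for i k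
    unfolding chain_sum_def
    by (subst kdx_sum) (simp_all add: regular_ker_jet_bracket kdx_kscale jet_bracket_Suc_left)
qed (simp_all add: kdx_add kdx_kscale chain_y.regular_ker_chain_sum regular_ker_jet_bracket)

lemma bracket_D_right: "bracket F (D G) = kdy (bracket F G)"
  unfolding bracket_chain_right
proof (rule chain_y.chain_sum_D)
  show "chain_sum at_x (\<lambda>u. jet_bracket u (i, Suc k)) F =
      kdy (chain_sum at_x (\<lambda>u. jet_bracket u (i, k)) F)" for i k
    unfolding chain_sum_def
    by (subst kdy_sum) (simp_all add: regular_ker_jet_bracket kdy_kscale jet_bracket_Suc_right)
qed (simp_all add: kdy_add kdy_kscale chain_x.regular_ker_chain_sum regular_ker_jet_bracket)

section \<open>The brackets of phi and psi, and that of their quotient\<close>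

lemma bracket_var: "bracket (var (i, 0)) (var (j, 0)) = w_bracket i j"
  by (simp add: bracket_chain_left jet_bracket_def)

text \<open>The nonzero entries of r are +1 in row (1,2), column (2,1), and -1 in row (2,1), column
  (1,2). The middle block puts plus or minus the determinant phi(x) psi(y) - psi(x) phi(y) in front
  of sign(x-y).\<close>

lemma w_bracket_entries:
  "w_bracket 1 1 = (0, [:var (False, 1, 0) * var (True, 1, 0):], 0, 0)"
  "w_bracket 2 2 = (0, [:var (False, 2, 0) * var (True, 2, 0):], 0, 0)"
  "w_bracket 1 2 = (- (var (False, 2, 0) * var (True, 1, 0)), [:var (False, 1, 0) * var (True, 2, 0):],
    var (False, 1, 0) * var (True, 2, 0) - var (False, 2, 0) * var (True, 1, 0), 0)"
  "w_bracket 2 1 = (var (False, 1, 0) * var (True, 2, 0), [:var (False, 2, 0) * var (True, 1, 0):],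
    var (False, 2, 0) * var (True, 1, 0) - var (False, 1, 0) * var (True, 2, 0), 0)"
  by (simp_all add: w_bracket_def R_mat_def a_ker_def sign_ker_def fun_ker_def kscale_eq sum_2
      c_mat_def r_mat_def kron_def e_mat_def f_mat_def zero_kernel cst_uminus)

text \<open>The function a enters each entry as a(x-y) w_i(x) w_j(y), so it cancels for a quotient
  of degree 0 in w. The coefficient of sign(x-y) vanishes to second order on the diagonal.\<close>

lemma bracket_eta_eta:
  "bracket eta eta = ((at_y eta)\<^sup>2 - (at_x eta)\<^sup>2, 0, (at_x eta - at_y eta)\<^sup>2, 0)"
proof -
  have nz: "var (2, 0) \<noteq> (0::onept)" by simp
  show ?thesis unfolding eta_def
    by (simp add: bracket_divide_left[OF nz] bracket_divide_right[OF nz] bracket_var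
        w_bracket_entries kscale_eq field_simps power2_eq_square)
qed

section \<open>The group action\<close>

lemma SL2_left_inverse:
  assumes "g \<in> SL2"
  obtains h :: "complex^2^2" where "\<forall>i j. (\<Sum>k\<in>UNIV. h $ i $ k * g $ k $ j) = (if i = j then 1 else 0)"
proof -
  have "invertible g" using assms by (simp add: SL2_def invertible_det_nz)
  then obtain h where "h ** g = mat 1" by (auto simp: invertible_def)
  then have "(h ** g) $ i $ j = (if i = j then 1 else 0)" for i j
    by (simp add: mat_def)
  then have "\<forall>i j. (\<Sum>k\<in>UNIV. h $ i $ k * g $ k $ j) = (if i = j then 1 else 0)"
    by (simp add: matrix_matrix_mult_def)
  then show thesis by (rule that)
qed

context
  fixes g assumes g: "g \<in> SL2"
begin

text \<open>Substituting with an inverse matrix undoes the action, so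
  \<open>subst_left_inverse\<close> makes the action total.\<close>

lemma is_field_hom_act: "is_field_hom (act g)"
proof -
  obtain h :: "complex^2^2" where h: "\<forall>i j. (\<Sum>k\<in>UNIV. h $ i $ k * g $ k $ j) = (if i = j then 1 else 0)"
    using g by (rule SL2_left_inverse)
  let ?s = "\<lambda>g (i, k). \<Sum>j\<in>UNIV. cst (g $ j $ i) * var (j, k) :: onept"
  have "subst_regular (?s h) (?s g u) \<and> subst (?s h) (?s g u) = var u" for u
  proof (cases u)
    case (Pair i k)
    have "subst_regular (?s h) (?s g u) \<and> subst (?s h) (?s g u) =
        cst (\<Sum>k\<in>UNIV. h $ 1 $ k * g $ k $ i) * var (1, k) + cst (\<Sum>k\<in>UNIV. h $ 2 $ k * g $ k $ i) * var (2, k)"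
      by (simp add: Pair sum_2 subst_regular_add subst_regular_mult cst_add cst_mult algebra_simps)
    moreover have "i = 1 \<or> i = 2" by (rule exhaust_2)
    ultimately show ?thesis unfolding h[rule_format] by (auto simp: Pair)
  qed
  then show ?thesis unfolding act_def by (intro is_field_hom_subst subst_left_inverse(1))
qed

lemma is_field_hom_act2: "is_field_hom (act2 g)"
proof -
  obtain h :: "complex^2^2" where h: "\<forall>i j. (\<Sum>k\<in>UNIV. h $ i $ k * g $ k $ j) = (if i = j then 1 else 0)"
    using g by (rule SL2_left_inverse)
  let ?s = "\<lambda>g (p, i, k). \<Sum>j\<in>UNIV. cst (g $ j $ i) * var (p, j, k) :: twopt"
  have "subst_regular (?s h) (?s g u) \<and> subst (?s h) (?s g u) = var u" for u
  proof (cases u)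
    case (fields p i k)
    have "subst_regular (?s h) (?s g u) \<and> subst (?s h) (?s g u) =
        cst (\<Sum>k\<in>UNIV. h $ 1 $ k * g $ k $ i) * var (p, 1, k) + cst (\<Sum>k\<in>UNIV. h $ 2 $ k * g $ k $ i) * var (p, 2, k)"
      by (simp add: fields sum_2 subst_regular_add subst_regular_mult cst_add cst_mult algebra_simps)
    moreover have "i = 1 \<or> i = 2" by (rule exhaust_2)
    ultimately show ?thesis unfolding h[rule_format] by (auto simp: fields)
  qed
  then show ?thesis unfolding act2_def by (intro is_field_hom_subst subst_left_inverse(1))
qed

lemmas act_hom = field_hom_simps[OF is_field_hom_act]
lemmas act2_hom = field_hom_simps[OF is_field_hom_act2]

lemma act_cst [simp]: "act g (cst c) = cst c"
  and act2_cst [simp]: "act2 g (cst c) = cst c"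
  by (simp_all add: act_def act2_def)

lemma act_var: "act g (var (i, k)) = cst (g $ 1 $ i) * var (1, k) + cst (g $ 2 $ i) * var (2, k)"
  and act2_var: "act2 g (var (p, i, k)) = cst (g $ 1 $ i) * var (p, 1, k) + cst (g $ 2 $ i) * var (p, 2, k)"
  by (simp_all add: act_def act2_def sum_2)

lemma act_D: "act g (D F) = D (act g F)"
  by (rule derivation_eqI[OF is_field_hom_act
      is_derivation_hom_comp[OF is_derivation_D is_field_hom_act]
      is_derivation_comp_hom[OF is_derivation_D is_field_hom_act]])
    (auto simp: act_var act_hom D_rules)

lemma act2_Dx: "act2 g (Dx F) = Dx (act2 g F)"
  by (rule derivation_eqI[OF is_field_hom_act2
      is_derivation_hom_comp[OF is_derivation_Dx is_field_hom_act2]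
      is_derivation_comp_hom[OF is_derivation_Dx is_field_hom_act2]])
    (auto simp: act2_var act2_hom Dx_rules)

lemma act2_Dy: "act2 g (Dy F) = Dy (act2 g F)"
  by (rule derivation_eqI[OF is_field_hom_act2
      is_derivation_hom_comp[OF is_derivation_Dy is_field_hom_act2]
      is_derivation_comp_hom[OF is_derivation_Dy is_field_hom_act2]])
    (auto simp: act2_var act2_hom Dy_rules)

lemma is_field_hom_comp: "is_field_hom h \<Longrightarrow> is_field_hom h' \<Longrightarrow> is_field_hom (\<lambda>f. h (h' f))"
  by (simp add: is_field_hom_def)

lemma act2_at_x [simp]: "act2 g (at_x F) = at_x (act g F)"
  by (rule field_hom_eqI[OF is_field_hom_comp[OF is_field_hom_act2 is_field_hom_at_x]
      is_field_hom_comp[OF is_field_hom_at_x is_field_hom_act]])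
    (auto simp: act2_var act_var)

lemma act2_at_y [simp]: "act2 g (at_y F) = at_y (act g F)"
  by (rule field_hom_eqI[OF is_field_hom_comp[OF is_field_hom_act2 is_field_hom_at_y]
      is_field_hom_comp[OF is_field_hom_at_y is_field_hom_act]])
    (auto simp: act2_var act_var)

lemma act2_tens: "S \<in> tens L \<Longrightarrow> act2 g S \<in> tens UNIV"
  by (induction rule: tens.induct) (simp_all add: act2_hom)

text \<open>The same matrix acts at both points, so the action commutes with setting x = y. This
  controls the delta coefficients that arise when an invariant sign coefficient is
  differentiated.\<close>

lemma diag_act2: "S \<in> tens L \<Longrightarrow> diag (act2 g S) = act g (diag S)"
proof (induction rule: tens.induct)
  case (tens_add S T)
  then have "S \<in> tens UNIV" "T \<in> tens UNIV" "act2 g S \<in> tens UNIV" "act2 g T \<in> tens UNIV"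
    using tens_UNIV act2_tens by blast+
  then show ?case using tens_add by (simp add: act2_hom(2) act_hom(2))
next
  case (tens_mult S T)
  then have "S \<in> tens UNIV" "T \<in> tens UNIV" "act2 g S \<in> tens UNIV" "act2 g T \<in> tens UNIV"
    using tens_UNIV act2_tens by blast+
  then show ?case using tens_mult by (simp add: act2_hom(3) act_hom(3))
qed simp_all

end


section \<open>Differential fields and invariants\<close>

lemma diff_subfield_hull:
  fixes S :: "'v::linorder ratfun set"
  shows "diff_subfield Ds (diff_subfield Ds hull S)"
proof -
  have Inter: "diff_subfield Ds (\<Inter>T)" if T: "\<And>K. K \<in> T \<Longrightarrow> diff_subfield Ds K" for T :: "'v ratfun set set"
    unfolding diff_subfield_def
  proof (intro conjI ballI subsetI InterI)
    fix K and f :: "'v ratfun" assume K: "K \<in> T" and "f \<in> range cst"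
    then show "f \<in> K" using diff_subfieldD(1)[OF T[OF K]] by auto
  next
    fix K and f g :: "'v ratfun" assume K: "K \<in> T" and fg: "f \<in> \<Inter>T" "g \<in> \<Inter>T"
    then have "f \<in> K" "g \<in> K" by blast+
    then show "f + g \<in> K" "f - g \<in> K" "f * g \<in> K" "f / g \<in> K"
      by (rule diff_subfieldD(2-5)[OF T[OF K]])+
  next
    fix d and f :: "'v ratfun" and K assume d: "d \<in> Ds" and f: "f \<in> d ` \<Inter>T" and K: "K \<in> T"
    obtain g where "f = d g" "g \<in> K" using f K by blast
    then show "f \<in> K" using diff_subfieldD(6)[OF T[OF K] d] by simp
  qed
  show ?thesis unfolding hull_def by (rule Inter) simp
qed

lemma diff_subfield_dfield: "diff_subfield {D} (dfield f)"
  by (simp add: dfield_def diff_subfield_hull)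

lemma dfield_generator [simp]: "f \<in> dfield f"
  using hull_subset[of "{f}"] by (auto simp: dfield_def)

lemma dfield_least: "diff_subfield {D} K \<Longrightarrow> f \<in> K \<Longrightarrow> dfield f \<subseteq> K"
  unfolding dfield_def by (rule hull_minimal) auto

lemma dfield_D: "F \<in> dfield f \<Longrightarrow> D F \<in> dfield f"
  by (rule diff_subfieldD(6)[OF diff_subfield_dfield]) auto

lemmas dfield_intros = diff_subfield_intros(1-5,7-)[OF diff_subfield_dfield] dfield_D

lemma diff_subfield_invariants:
  assumes "K \<subseteq> SL2"
  shows "diff_subfield {D} (invariants K)"
proof -
  have "act g (cst c) = cst c" "act g (F + G) = act g F + act g G" "act g (F - G) = act g F - act g G"
    "act g (F * G) = act g F * act g G" "act g (F / G) = act g F / act g G" "act g (D F) = D (act g F)"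
    if "g \<in> K" for g F G c
  proof -
    have g: "g \<in> SL2" using that assms by auto
    show "act g (cst c) = cst c" "act g (F + G) = act g F + act g G" "act g (F - G) = act g F - act g G"
      "act g (F * G) = act g F * act g G" "act g (F / G) = act g F / act g G" "act g (D F) = D (act g F)"
      by (simp_all add: act_hom[OF g] act_cst[OF g] act_D[OF g])
  qed
  then show ?thesis
    unfolding diff_subfield_def invariants_def by (auto intro: dfield_intros)
qed

section \<open>Simple extensions of a differential field, and descent along them\<close>

definition coeffs_in :: "'a::zero set \<Rightarrow> 'a poly \<Rightarrow> bool" where
  "coeffs_in L P \<longleftrightarrow> (\<forall>k. Polynomial.coeff P k \<in> L)"

context
  fixes L assumes L: "diff_subfield {D} L"
begin

lemma coeffs_in_0: "coeffs_in L 0"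
  by (simp add: coeffs_in_def diff_subfield_0[OF L])

lemma coeffs_in_pCons: "coeffs_in L (pCons c P) \<longleftrightarrow> c \<in> L \<and> coeffs_in L P"
  unfolding coeffs_in_def by (metis coeff_pCons_0 coeff_pCons_Suc not0_implies_Suc)

lemma coeffs_in_add: "coeffs_in L P \<Longrightarrow> coeffs_in L Q \<Longrightarrow> coeffs_in L (P + Q)"
  and coeffs_in_diff: "coeffs_in L P \<Longrightarrow> coeffs_in L Q \<Longrightarrow> coeffs_in L (P - Q)"
  and coeffs_in_uminus: "coeffs_in L P \<Longrightarrow> coeffs_in L (- P)"
  and coeffs_in_map_D: "coeffs_in L P \<Longrightarrow> coeffs_in L (map_poly D P)"
  using diff_subfieldD[OF L] diff_subfield_uminus[OF L]
  by (simp_all add: coeffs_in_def coeff_map_poly D_rules)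

lemma coeffs_in_mult: "coeffs_in L P \<Longrightarrow> coeffs_in L Q \<Longrightarrow> coeffs_in L (P * Q)"
  unfolding coeffs_in_def coeff_mult
  by (blast intro: diff_subfield_sum[OF L] diff_subfieldD(4)[OF L])

lemma coeffs_in_pderiv: "coeffs_in L P \<Longrightarrow> coeffs_in L (pderiv P)"
  unfolding coeffs_in_def coeff_pderiv
  by (blast intro: diff_subfield_of_nat[OF L] diff_subfieldD(4)[OF L])

lemma coeffs_in_1: "coeffs_in L 1"
  using coeffs_in_pCons[of 1 0] coeffs_in_0 diff_subfield_1[OF L] by (simp add: one_pCons)

lemma poly_in: "coeffs_in L P \<Longrightarrow> x \<in> L \<Longrightarrow> poly P x \<in> L"
  by (induction P) (auto simp: coeffs_in_pCons intro!: diff_subfield_intros(2,4,7)[OF L])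

lemma hom_poly:
  assumes "is_field_hom h" "\<And>f. f \<in> L \<Longrightarrow> h f = f" "coeffs_in L P"
  shows "h (poly P t) = poly P (h t)"
  using assms(3)
  by (induction P) (simp_all add: coeffs_in_pCons assms(2) field_hom_simps[OF assms(1)])

lemma D_poly: "D (poly P t) = poly (map_poly D P) t + poly (pderiv P) t * D t"
  by (induction P) (simp_all add: D_rules map_poly_pCons_0 pderiv_pCons algebra_simps)

text \<open>The field L(t), described by values of fractions at \<open>t\<close>, whether or not
  \<open>t\<close> is transcendental over \<open>L\<close>.\<close>

definition simple_extension :: "onept \<Rightarrow> onept set" where
  "simple_extension t = {poly P t / poly Q t | P Q. coeffs_in L P \<and> coeffs_in L Q \<and> poly Q t \<noteq> 0}"

lemma simple_extensionI: "coeffs_in L P \<Longrightarrow> coeffs_in L Q \<Longrightarrow> poly Q t \<noteq> 0 \<Longrightarrow>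
    F = poly P t / poly Q t \<Longrightarrow> F \<in> simple_extension t"
  unfolding simple_extension_def by blast

lemma simple_extensionE:
  assumes "F \<in> simple_extension t"
  obtains P Q where "coeffs_in L P" "coeffs_in L Q" "poly Q t \<noteq> 0" "F = poly P t / poly Q t"
  using assms unfolding simple_extension_def by blast

lemma poly_in_simple_extension: "coeffs_in L P \<Longrightarrow> poly P t \<in> simple_extension t"
  by (rule simple_extensionI[of P 1]) (simp_all add: coeffs_in_1)

lemma subset_simple_extension: "f \<in> L \<Longrightarrow> f \<in> simple_extension t"
  using poly_in_simple_extension[of "[:f:]" t] by (simp add: coeffs_in_pCons coeffs_in_0)

lemma generator_in_simple_extension: "t \<in> simple_extension t"
  using poly_in_simple_extension[of "[:0, 1:]" t]
  by (simp add: coeffs_in_pCons coeffs_in_0 diff_subfield_0[OF L] diff_subfield_1[OF L])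

lemma simple_extension_arith:
  assumes "F \<in> simple_extension t" "G \<in> simple_extension t"
  shows "F + G \<in> simple_extension t" "F - G \<in> simple_extension t"
    "F * G \<in> simple_extension t" "F / G \<in> simple_extension t"
proof -
  obtain P Q where F: "coeffs_in L P" "coeffs_in L Q" "poly Q t \<noteq> 0" "F = poly P t / poly Q t"
    using assms(1) by (rule simple_extensionE)
  obtain P' Q' where G: "coeffs_in L P'" "coeffs_in L Q'" "poly Q' t \<noteq> 0" "G = poly P' t / poly Q' t"
    using assms(2) by (rule simple_extensionE)
  show "F + G \<in> simple_extension t"
    by (rule simple_extensionI[of "P * Q' + P' * Q" "Q * Q'"])
      (use F(1-3) G(1-3) in \<open>auto simp: F(4) G(4) field_simps intro!: coeffs_in_add coeffs_in_mult\<close>)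
  show "F - G \<in> simple_extension t"
    by (rule simple_extensionI[of "P * Q' - P' * Q" "Q * Q'"])
      (use F(1-3) G(1-3) in \<open>auto simp: F(4) G(4) field_simps intro!: coeffs_in_diff coeffs_in_mult\<close>)
  show "F * G \<in> simple_extension t"
    by (rule simple_extensionI[of "P * P'" "Q * Q'"])
      (use F(1-3) G(1-3) in \<open>auto simp: F(4) G(4) field_simps intro!: coeffs_in_mult\<close>)
  show "F / G \<in> simple_extension t"
  proof (cases "G = 0")
    \<comment> \<open>A quotient by 0 is 0 in HOL, and 0 lies in \<open>L\<close>.\<close>
    case True
    then show ?thesis
      using subset_simple_extension[OF diff_subfield_0[OF L], of t] by simp
  next
    case False
    show ?thesis
      by (rule simple_extensionI[of "P * Q'" "Q * P'"])
        (use F(1-3) G(1-3) False in \<open>auto simp: F(4) G(4) field_simps intro!: coeffs_in_mult\<close>)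
  qed
qed

text \<open>Once \<open>D t\<close> lies in L(t), no higher derivatives of \<open>t\<close> have to
  be adjoined.\<close>

lemma diff_subfield_simple_extension:
  assumes "D t \<in> simple_extension t"
  shows "diff_subfield {D} (simple_extension t)"
proof -
  have DP: "D (poly P t) \<in> simple_extension t" if "coeffs_in L P" for P
    unfolding D_poly using that assms
    by (intro simple_extension_arith poly_in_simple_extension coeffs_in_map_D coeffs_in_pderiv)
  have "D F \<in> simple_extension t" if F: "F \<in> simple_extension t" for F
  proof -
    obtain P Q where PQ: "coeffs_in L P" "coeffs_in L Q" "poly Q t \<noteq> 0" "F = poly P t / poly Q t"
      using F by (rule simple_extensionE)
    show ?thesis
      unfolding PQ(4) D_divide[OF PQ(3)] power2_eq_square using PQ
      by (intro simple_extension_arith poly_in_simple_extension DP)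
  qed
  then show ?thesis
    unfolding diff_subfield_def
    using simple_extension_arith subset_simple_extension diff_subfieldD(1)[OF L] by auto
qed

text \<open>The relation P(t) Q(s) = Q(t) P(s) holds for infinitely many s, hence for every s; specializing s
  to a constant c with Q(c) nonzero exhibits P(t) / Q(t) as the element P(c) / Q(c) of L.\<close>
lemma simple_extension_descent:
  assumes F: "F \<in> simple_extension t" and T: "infinite T"
    and homs: "\<And>s. s \<in> T \<Longrightarrow> \<exists>h. is_field_hom h \<and> (\<forall>f\<in>L. h f = f) \<and> h t = s \<and> h F = F"
  shows "F \<in> L"
proof -
  obtain P Q where PQ: "coeffs_in L P" "coeffs_in L Q" "poly Q t \<noteq> 0" "F = poly P t / poly Q t"
    using F by (rule simple_extensionE)
  let ?R = "Polynomial.smult (poly P t) Q - Polynomial.smult (poly Q t) P"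
  have "poly ?R s = 0" if s: "s \<in> T" for s
  proof -
    obtain h where h: "is_field_hom h" "\<And>f. f \<in> L \<Longrightarrow> h f = f" "h t = s" "h F = F"
      using homs[OF s] by blast
    have "h (poly Q t) \<noteq> 0" using PQ(3) by (simp add: field_hom_eq_0_iff[OF h(1)])
    moreover have "h (poly P t) / h (poly Q t) = poly P t / poly Q t"
      using h(4) by (simp add: PQ(4) field_hom_divide[OF h(1)])
    ultimately have "h (poly P t) * poly Q t = h (poly Q t) * poly P t"
      using PQ(3) by (simp add: frac_eq_eq mult.commute)
    then show ?thesis
      by (simp add: hom_poly[OF h(1,2)] PQ(1,2) h(3) mult.commute)
  qed
  then have "T \<subseteq> {s. poly ?R s = 0}" by auto
  then have R: "?R = 0" using T poly_roots_finite finite_subset by blast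
  have "Q \<noteq> 0" using PQ(3) by auto
  then have "finite {s. poly Q s = 0}" by (rule poly_roots_finite)
  moreover have "infinite (range (cst :: complex \<Rightarrow> onept))"
    by (simp add: finite_image_iff inj_on_def infinite_UNIV_char_0)
  ultimately obtain c where c: "poly Q (cst c) \<noteq> 0"
    by (metis (mono_tags, lifting) finite_subset image_subset_iff mem_Collect_eq)
  have "poly ?R (cst c) = 0" by (simp only: R poly_0)
  then have "F = poly P (cst c) / poly Q (cst c)"
    using c PQ(3) by (simp add: PQ(4) frac_eq_eq mult.commute)
  then show ?thesis
    using PQ(1,2) diff_subfieldD(1)[OF L] by (auto intro!: diff_subfieldD(5)[OF L] poly_in)
qed

end

lemma dfield_subset_simple_extension:
  assumes "D t \<in> simple_extension (dfield f) t"
  shows "dfield t \<subseteq> simple_extension (dfield f) t"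
  using assms by (intro dfield_least diff_subfield_simple_extension diff_subfield_dfield
      generator_in_simple_extension)

section \<open>The generators and their transformation laws\<close>

definition log_deriv_eta :: onept where
  "log_deriv_eta = theta / eta"

lemma eta_neq_0: "eta \<noteq> 0"
  by (simp add: eta_def)

lemma D_eta: "D eta = theta"
  by (simp add: theta_def)

text \<open>The numerator of theta is phi' psi - phi psi', and its partial derivative by phi' is
  psi, which is not zero.\<close>

lemma theta_neq_0: "theta \<noteq> 0"
proof
  assume "theta = 0"
  then have "var (1, 1) * var (2, 0) - var (1, 0) * var (2, 1) = (0::onept)"
    by (simp add: theta_def eta_def D_divide)
  then have "pdiff (1, 1) (var (1, 1) * var (2, 0) - var (1, 0) * var (2, 1)) = pdiff (1, 1) (0::onept)"
    by simp
  then show False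
    by (simp add: derivation_diff[OF is_field_hom_id is_derivation_pdiff]
        derivation_0[OF is_field_hom_id is_derivation_pdiff] pdiff_mult pdiff_var)
qed

lemma v_inv_theta: "v_inv = 1/2 * (D theta / theta)"
  by (simp add: v_inv_def theta_def numeral_2_eq_2)

lemma D_theta: "D theta = 2 * v_inv * theta"
  by (simp add: v_inv_theta theta_neq_0)

text \<open>The Miura transformation: half the Schwarzian expressed through half the logarithmic
  derivative of eta'.\<close>

lemma u_inv_v: "u_inv = D v_inv - v_inv\<^sup>2"
proof -
  have "D v_inv = (D (D theta) * theta - (D theta)\<^sup>2) / (2 * theta\<^sup>2)"
    unfolding v_inv_theta
    by (simp add: D_rules D_divide theta_neq_0 power2_eq_square field_simps)
  then have "D v_inv - v_inv\<^sup>2 =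
      (D (D theta) * theta - (D theta)\<^sup>2) / (2 * theta\<^sup>2) - (1/2 * (D theta / theta))\<^sup>2"
    by (simp only: v_inv_theta)
  also have "\<dots> = 1/2 * (D (D theta) / theta - 3/2 * (D theta / theta)\<^sup>2)"
    using theta_neq_0 by (simp add: field_simps power2_eq_square)
  finally show ?thesis
    by (simp add: u_inv_def schwarzian_def theta_def numeral_2_eq_2 numeral_3_eq_3)
qed

context
  fixes g assumes g: "g \<in> SL2"
begin

text \<open>The denominator cannot vanish, because its product with psi is the image of psi under an
  injective homomorphism.\<close>

lemma act_eta:
  "cst (g $ 1 $ 2) * eta + cst (g $ 2 $ 2) \<noteq> 0"
  "act g eta = (cst (g $ 1 $ 1) * eta + cst (g $ 2 $ 1)) / (cst (g $ 1 $ 2) * eta + cst (g $ 2 $ 2))"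
proof -
  have psi: "act g (var (2, 0)) = (cst (g $ 1 $ 2) * eta + cst (g $ 2 $ 2)) * var (2, 0)"
    and phi: "act g (var (1, 0)) = (cst (g $ 1 $ 1) * eta + cst (g $ 2 $ 1)) * var (2, 0)"
    unfolding act_var[OF g] eta_def by (simp_all add: field_simps)
  have "act g (var (2, 0)) \<noteq> 0" by (simp add: act_hom[OF g])
  then show "cst (g $ 1 $ 2) * eta + cst (g $ 2 $ 2) \<noteq> 0" unfolding psi by auto
  have "act g eta = act g (var (1, 0)) / act g (var (2, 0))"
    unfolding eta_def by (rule act_hom(8)[OF g])
  then show "act g eta = (cst (g $ 1 $ 1) * eta + cst (g $ 2 $ 1)) / (cst (g $ 1 $ 2) * eta + cst (g $ 2 $ 2))"
    unfolding psi phi by simp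
qed

lemma act_theta: "act g theta = theta / (cst (g $ 1 $ 2) * eta + cst (g $ 2 $ 2))\<^sup>2"
proof -
  have "g $ 1 $ 1 * g $ 2 $ 2 - g $ 1 $ 2 * g $ 2 $ 1 = 1"
    using g by (simp add: SL2_def det_2)
  then have det: "cst (g $ 1 $ 1) * cst (g $ 2 $ 2) - cst (g $ 1 $ 2) * cst (g $ 2 $ 1) = (1 :: onept)"
    by (metis cst_1 cst_diff cst_mult)
  have "act g theta = D (act g eta)" by (simp add: theta_def act_D[OF g])
  also have "\<dots> = (cst (g $ 1 $ 1) * cst (g $ 2 $ 2) - cst (g $ 1 $ 2) * cst (g $ 2 $ 1)) * theta /
      (cst (g $ 1 $ 2) * eta + cst (g $ 2 $ 2))\<^sup>2"
    unfolding act_eta(2) D_divide[OF act_eta(1)] by (simp add: D_rules D_eta algebra_simps)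
  finally show ?thesis by (simp add: det)
qed

text \<open>The action divides theta by d^2. Since v is half the logarithmic derivative of theta, it
  is shifted by minus the logarithmic derivative d'/d.\<close>

lemma act_v_inv:
  "act g v_inv = v_inv - cst (g $ 1 $ 2) * theta / (cst (g $ 1 $ 2) * eta + cst (g $ 2 $ 2))"
proof -
  define b d where "b = cst (g $ 1 $ 2)" and "d = b * eta + cst (g $ 2 $ 2)"
  have d: "d \<noteq> 0" and Dd: "D d = b * theta"
    using act_eta(1) by (simp_all add: d_def b_def D_rules D_eta)
  have th: "act g theta = theta / d\<^sup>2" by (simp add: act_theta d_def b_def)
  have "D (act g theta) = (D theta - 2 * b * theta\<^sup>2 / d) / d\<^sup>2"
    using d by (simp add: th D_divide D_rules Dd field_simps power2_eq_square)
  then have "act g v_inv = 1/2 * ((D theta - 2 * b * theta\<^sup>2 / d) / theta)"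
    using d by (simp add: v_inv_theta act_hom[OF g] act_D[OF g] th)
  also have "\<dots> = v_inv - b * theta / d"
    using d theta_neq_0 by (simp add: v_inv_theta field_simps power2_eq_square)
  finally show ?thesis by (simp add: d_def b_def)
qed

text \<open>The shift m = d'/d of v satisfies the Riccati equation m' = 2 v m - m^2, which is what
  makes v' - v^2 insensitive to replacing v by v - m.\<close>

lemma act_u_inv: "act g u_inv = u_inv"
proof -
  define b d where "b = cst (g $ 1 $ 2)" and "d = b * eta + cst (g $ 2 $ 2)"
  have d: "d \<noteq> 0" and Dd: "D d = b * theta"
    using act_eta(1) by (simp_all add: d_def b_def D_rules D_eta)
  have v: "act g v_inv = v_inv - b * theta / d" by (simp add: act_v_inv d_def b_def)
  have "D (act g v_inv) = D v_inv - D (b * theta / d)" by (simp add: v D_rules)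
  also have "D (b * theta / d) = (b * (2 * v_inv * theta) * d - b * theta * (b * theta)) / d\<^sup>2"
    using d by (simp add: D_divide D_rules Dd D_theta b_def)
  finally have "D (act g v_inv) - (act g v_inv)\<^sup>2 = D v_inv - v_inv\<^sup>2"
    using d by (simp add: v field_simps power2_eq_square)
  then show ?thesis by (simp add: u_inv_v act_hom[OF g] act_D[OF g])
qed

end

lemma theta_in: "theta \<in> dfield eta"
  and v_inv_in: "v_inv \<in> dfield eta"
  and u_inv_in: "u_inv \<in> dfield eta"
  and log_deriv_eta_in: "log_deriv_eta \<in> dfield eta"
proof -
  show th: "theta \<in> dfield eta" by (simp add: theta_def dfield_D)
  show v: "v_inv \<in> dfield eta" unfolding v_inv_theta using th by (intro dfield_intros)
  show "u_inv \<in> dfield eta" unfolding u_inv_v using v by (intro dfield_intros)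
  show "log_deriv_eta \<in> dfield eta" unfolding log_deriv_eta_def using th
    by (intro dfield_intros) simp_all
qed

lemma subgroups_SL2: "lower_B \<subseteq> SL2" "lower_N \<subseteq> SL2" "diag_H \<subseteq> SL2" "lower_N \<subseteq> lower_B" "diag_H \<subseteq> lower_B"
  by (auto simp: lower_B_def lower_N_def diag_H_def)

lemma theta_invariant: "theta \<in> invariants lower_N"
proof -
  have "act g theta = theta" if "g \<in> lower_N" for g
    using that act_theta[of g] by (simp add: lower_N_def lower_B_def)
  then show ?thesis using theta_in by (simp add: invariants_def)
qed

lemma v_inv_invariant: "v_inv \<in> invariants lower_B"
proof -
  have "act g v_inv = v_inv" if "g \<in> lower_B" for g
    using that act_v_inv[of g] by (simp add: lower_B_def)
  then show ?thesis using v_inv_in by (simp add: invariants_def)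
qed

lemma u_inv_invariant: "u_inv \<in> invariants SL2"
  using u_inv_in by (auto simp: invariants_def act_u_inv)

lemma log_deriv_eta_invariant: "log_deriv_eta \<in> invariants diag_H"
proof -
  have "act g log_deriv_eta = log_deriv_eta" if gH: "g \<in> diag_H" for g
  proof -
    have g: "g \<in> SL2" using gH subgroups_SL2 by auto
    have e: "g $ 1 $ 2 = 0" "g $ 2 $ 1 = 0" "g $ 1 $ 1 * g $ 2 $ 2 = 1"
      using gH by (auto simp: diag_H_def SL2_def det_2)
    have "cst (g $ 1 $ 1) * cst (g $ 2 $ 2) = (1::onept)" by (metis e(3) cst_1 cst_mult)
    moreover have "cst (g $ 2 $ 2) \<noteq> (0::onept)" using e(3) by auto
    ultimately show ?thesis
      using eta_neq_0
      by (simp add: log_deriv_eta_def act_hom[OF g] act_eta[OF g] act_theta[OF g] e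
          field_simps power2_eq_square)
  qed
  then show ?thesis using log_deriv_eta_in by (simp add: invariants_def)
qed

lemma dfield_subset_invariants:
  "K \<subseteq> SL2 \<Longrightarrow> f \<in> invariants K \<Longrightarrow> dfield f \<subseteq> invariants K"
  by (rule dfield_least[OF diff_subfield_invariants])

section \<open>The invariant fields of the subgroups\<close>

definition matrix2 :: "complex \<Rightarrow> complex \<Rightarrow> complex \<Rightarrow> complex \<Rightarrow> complex^2^2" where
  "matrix2 a b c d = vector [vector [a, b], vector [c, d]]"

lemma matrix2_entries [simp]:
  "matrix2 a b c d $ 1 $ 1 = a" "matrix2 a b c d $ 1 $ 2 = b"
  "matrix2 a b c d $ 2 $ 1 = c" "matrix2 a b c d $ 2 $ 2 = d"
  by (simp_all add: matrix2_def)

lemma matrix2_SL2 [simp]: "matrix2 a b c d \<in> SL2 \<longleftrightarrow> a * d - b * c = 1"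
  by (simp add: SL2_def det_2)

text \<open>One step of the tower. The translates of \<open>t\<close> are taken in the ambient field
  and may leave \<open>dfield t\<close>: the lower triangular subgroup is not normal, and SL2 does
  not preserve its field of invariants.\<close>

lemma invariants_eq_dfield:
  assumes K: "K \<subseteq> SL2" and f: "f \<in> invariants K"
    and gen: "invariants K \<subseteq> dfield t" and D: "D t \<in> simple_extension (dfield f) t"
    and inf: "infinite ((\<lambda>g. act g t) ` K)"
  shows "invariants K = dfield f"
proof
  show "dfield f \<subseteq> invariants K" using K f by (rule dfield_subset_invariants)
  show "invariants K \<subseteq> dfield f"
  proof
    fix F assume F: "F \<in> invariants K"
    show "F \<in> dfield f"
    proof (rule simple_extension_descent[OF diff_subfield_dfield _ inf])
      show "F \<in> simple_extension (dfield f) t"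
        using F gen dfield_subset_simple_extension[OF D] by auto
    next
      fix s assume "s \<in> (\<lambda>g. act g t) ` K"
      then obtain g where g: "g \<in> K" "s = act g t" by auto
      then have "is_field_hom (act g)" using K is_field_hom_act by auto
      moreover have "act g F = F" "\<forall>x\<in>dfield f. act g x = x"
        using F g(1) dfield_subset_invariants[OF K f] by (auto simp: invariants_def)
      ultimately show "\<exists>h. is_field_hom h \<and> (\<forall>x\<in>dfield f. h x = x) \<and> h t = s \<and> h F = F"
        using g(2) by blast
    qed
  qed
qed

lemma invariants_subset_dfield_eta: "invariants K \<subseteq> dfield eta"
  by (auto simp: invariants_def)

lemma invariants_antimono: "K \<subseteq> K' \<Longrightarrow> invariants K' \<subseteq> invariants K"
  by (auto simp: invariants_def)

lemma infinite_inj_image: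
  fixes f :: "complex \<Rightarrow> 'a"
  assumes "inj_on f (- {0})" "f ` (- {0}) \<subseteq> T"
  shows "infinite T"
proof -
  have "infinite (- {0::complex})" by (simp add: Compl_eq_Diff_UNIV infinite_UNIV_char_0)
  then show ?thesis using assms finite_imageD finite_subset by blast
qed

text \<open>The matrix diag(a, 1/a) multiplies eta and theta by a^2; the square root makes the
  factor an arbitrary nonzero c.\<close>

lemma matrix2_scaling:
  assumes "c \<noteq> 0"
  shows "matrix2 (csqrt c) 0 0 (1 / csqrt c) \<in> diag_H"
    "cst (csqrt c) * cst (csqrt c) = cst c"
  using assms power2_csqrt[of c]
  by (auto simp: diag_H_def cst_mult[symmetric] power2_eq_square)

lemma invariants_lower_N: "invariants lower_N = dfield theta"
proof (rule invariants_eq_dfield[OF _ theta_invariant invariants_subset_dfield_eta])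
  show "D eta \<in> simple_extension (dfield theta) eta"
    unfolding D_eta by (intro subset_simple_extension diff_subfield_dfield dfield_generator)
  show "infinite ((\<lambda>g. act g eta) ` lower_N)"
  proof (rule infinite_inj_image)
    \<comment> \<open>These matrices send eta to eta + c.\<close>
    show "inj_on (\<lambda>c. act (matrix2 1 0 c 1) eta) (- {0})"
      by (auto simp: inj_on_def act_eta)
  qed (auto simp: lower_N_def lower_B_def)
qed (rule subgroups_SL2)

lemma invariants_diag_H: "invariants diag_H = dfield log_deriv_eta"
proof (rule invariants_eq_dfield[OF _ log_deriv_eta_invariant invariants_subset_dfield_eta])
  have "D eta = log_deriv_eta * eta" using eta_neq_0 by (simp add: log_deriv_eta_def D_eta)
  then show "D eta \<in> simple_extension (dfield log_deriv_eta) eta"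
    by (simp only:) (intro simple_extension_arith generator_in_simple_extension
        subset_simple_extension diff_subfield_dfield dfield_generator)
  show "infinite ((\<lambda>g. act g eta) ` diag_H)"
  proof (rule infinite_inj_image)
    show "inj_on (\<lambda>c. act (matrix2 (csqrt c) 0 0 (1 / csqrt c)) eta) (- {0})"
      using eta_neq_0 by (auto simp: inj_on_def act_eta matrix2_scaling cst_divide)
  qed (auto simp: matrix2_scaling)
qed (rule subgroups_SL2)

lemma invariants_lower_B: "invariants lower_B = dfield v_inv"
proof (rule invariants_eq_dfield[OF _ v_inv_invariant])
  \<comment> \<open>Invariance under the unipotent subgroup already confines the field to
    \<open>dfield theta\<close>, so theta is the element to be moved by the torus.\<close>
  show "invariants lower_B \<subseteq> dfield theta"
    using invariants_antimono[OF subgroups_SL2(4)] invariants_lower_N by simp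
  show "D theta \<in> simple_extension (dfield v_inv) theta"
    unfolding D_theta mult.assoc
    by (intro simple_extension_arith generator_in_simple_extension subset_simple_extension
        diff_subfield_dfield diff_subfield_numeral[OF diff_subfield_dfield] dfield_generator)
  show "infinite ((\<lambda>g. act g theta) ` lower_B)"
  proof (rule infinite_inj_image)
    show "inj_on (\<lambda>c. act (matrix2 (csqrt c) 0 0 (1 / csqrt c)) theta) (- {0})"
      using theta_neq_0
      by (auto simp: inj_on_def act_theta matrix2_scaling cst_divide power2_eq_square)
  qed (use subgroups_SL2(5) matrix2_scaling in blast)
qed (rule subgroups_SL2)

lemma invariants_SL2: "invariants SL2 = dfield u_inv"
proof (rule invariants_eq_dfield[OF _ u_inv_invariant])
  show "invariants SL2 \<subseteq> dfield v_inv"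
    using invariants_antimono[OF subgroups_SL2(1)] invariants_lower_B by simp
  have "D v_inv = u_inv + v_inv * v_inv" by (simp add: u_inv_v power2_eq_square)
  then show "D v_inv \<in> simple_extension (dfield u_inv) v_inv"
    by (simp only:) (intro simple_extension_arith generator_in_simple_extension
        subset_simple_extension diff_subfield_dfield dfield_generator)
  show "infinite ((\<lambda>g. act g v_inv) ` SL2)"
  proof (rule infinite_inj_image)
    \<comment> \<open>The translates are v - b theta / (b eta + 1). After cross-multiplication the
      terms with eta theta cancel, leaving (b - c) theta = 0.\<close>
    show "inj_on (\<lambda>b. act (matrix2 1 b 0 1) v_inv) (- {0})"
    proof (rule inj_onI)
      fix b c :: complex
      assume "act (matrix2 1 b 0 1) v_inv = act (matrix2 1 c 0 1) v_inv"
      moreover have "cst b * eta + 1 \<noteq> 0" "cst c * eta + 1 \<noteq> 0"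
        using act_eta(1)[of "matrix2 1 b 0 1"] act_eta(1)[of "matrix2 1 c 0 1"] by simp_all
      ultimately have "cst b * theta * (cst c * eta + 1) = cst c * theta * (cst b * eta + 1)"
        by (simp add: act_v_inv frac_eq_eq)
      then have "(cst b - cst c) * theta = 0" by (simp add: algebra_simps)
      then show "b = c" using theta_neq_0 by simp
    qed
  qed auto
qed simp

section \<open>Closure of the invariants under the bracket\<close>

text \<open>Unlike invariant_kernels, this set is visibly stable under kdx and kdy: its coefficients are
  regular on the diagonal.\<close>
definition regular_invariant_kernels :: "(complex^2^2) set \<Rightarrow> kernel set" where
  "regular_invariant_kernels K =
     {(A, 0, S, Q) | A S Q. A \<in> tens (dfield eta) \<and> S \<in> tens (dfield eta) \<and>
       (\<forall>g\<in>K. act2 g A = A \<and> act2 g S = S) \<and> coeffs_in (invariants K) Q}"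

lemma regular_invariant_kernels_iff:
  "(A, P, S, Q) \<in> regular_invariant_kernels K \<longleftrightarrow>
    P = 0 \<and> A \<in> tens (dfield eta) \<and> S \<in> tens (dfield eta) \<and>
    (\<forall>g\<in>K. act2 g A = A \<and> act2 g S = S) \<and> coeffs_in (invariants K) Q"
  by (auto simp: regular_invariant_kernels_def)

text \<open>The preimages of \<open>dfield2_eta\<close> under \<open>at_x\<close> and
  \<open>at_y\<close> are differential fields containing eta, hence contain
  \<open>dfield eta\<close>.\<close>

lemma tens_dfield_eta_subset: "tens (dfield eta) \<subseteq> dfield2_eta"
proof
  have d2: "diff_subfield {Dx, Dy} dfield2_eta"
    unfolding dfield2_eta_def by (rule diff_subfield_hull)
  have gen: "at_x eta \<in> dfield2_eta" "at_y eta \<in> dfield2_eta"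
    using hull_subset[of "{at_x eta, at_y eta}"] by (auto simp: dfield2_eta_def)
  have x: "dfield eta \<subseteq> {f. at_x f \<in> dfield2_eta}"
  proof (rule dfield_least)
    show "diff_subfield {D} {f. at_x f \<in> dfield2_eta}"
      using diff_subfieldD(1-5)[OF d2] diff_subfieldD(6)[OF d2, of Dx]
      by (auto simp: diff_subfield_def simp flip: Dx_at_x)
  qed (simp add: gen)
  have y: "dfield eta \<subseteq> {f. at_y f \<in> dfield2_eta}"
  proof (rule dfield_least)
    show "diff_subfield {D} {f. at_y f \<in> dfield2_eta}"
      using diff_subfieldD(1-5)[OF d2] diff_subfieldD(6)[OF d2, of Dy]
      by (auto simp: diff_subfield_def simp flip: Dy_at_y)
  qed (simp add: gen)
  fix S assume "S \<in> tens (dfield eta)"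
  then show "S \<in> dfield2_eta"
    by (induction rule: tens.induct) (use x y diff_subfieldD(2,4)[OF d2] in auto)
qed

lemma regular_invariant_kernels_subset: "regular_invariant_kernels K \<subseteq> invariant_kernels K"
  using tens_dfield_eta_subset
  by (auto simp: regular_invariant_kernels_def invariant_kernels_def coeffs_in_def)

lemma coeffs_in_scale_delta:
  assumes "diff_subfield {D} L"
  shows "f \<in> tens L \<Longrightarrow> coeffs_in L Q \<Longrightarrow> coeffs_in L (scale_delta f Q)"
proof (induction Q arbitrary: f)
  case (pCons c Q)
  then show ?case
    using assms diag_tens[OF assms] tens_Dy[OF assms]
    by (auto simp: scale_delta_pCons coeffs_in_pCons coeffs_in_0
        intro!: coeffs_in_add diff_subfieldD(4)[OF assms] diff_subfield_0[OF assms])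
qed simp

context
  fixes K assumes K: "K \<subseteq> SL2"
begin

private lemma in_SL2: "g \<in> K \<Longrightarrow> g \<in> SL2"
  using K by auto

lemma act2_tens_invariants: "g \<in> K \<Longrightarrow> f \<in> tens (invariants K) \<Longrightarrow> act2 g f = f"
proof -
  assume g: "g \<in> K"
  assume "f \<in> tens (invariants K)"
  then show ?thesis
    by (induction rule: tens.induct)
      (use g in \<open>auto simp: in_SL2 act2_hom(2,3)[OF in_SL2[OF g]] invariants_def\<close>)
qed

lemma regular_invariant_kernels_0: "0 \<in> regular_invariant_kernels K"
  unfolding zero_kernel regular_invariant_kernels_iff
  using act2_hom(4)[OF in_SL2] diff_subfield_0[OF diff_subfield_invariants[OF K]]
  by (auto simp: coeffs_in_def tens_0[OF diff_subfield_dfield])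

lemma regular_invariant_kernels_add:
  "k \<in> regular_invariant_kernels K \<Longrightarrow> k' \<in> regular_invariant_kernels K \<Longrightarrow>
    k + k' \<in> regular_invariant_kernels K"
  by (cases k; cases k')
    (auto simp: regular_invariant_kernels_iff act2_hom(2)[OF in_SL2] tens_add
      intro: coeffs_in_add[OF diff_subfield_invariants[OF K]])

lemma regular_invariant_kernels_kscale:
  assumes f: "f \<in> tens (invariants K)" and k: "k \<in> regular_invariant_kernels K"
  shows "f \<odot> k \<in> regular_invariant_kernels K"
proof (cases k)
  case (fields A P S Q)
  have "f \<in> tens (dfield eta)"
    using f tens_mono[OF _ invariants_subset_dfield_eta] by auto
  then show ?thesis
    using k f coeffs_in_scale_delta[OF diff_subfield_invariants[OF K] f]
    by (auto simp: fields kscale_eq regular_invariant_kernels_iff act2_hom(3)[OF in_SL2]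
        act2_tens_invariants tens_mult)
qed

text \<open>Needed for the delta terms produced by \<open>kdx\<close> and \<open>kdy\<close>. The
  sign coefficient is invariant as a whole but need not be built from values of invariants, so
  \<open>diag_tens\<close> over the invariant field would not apply.\<close>

lemma diag_invariant:
  assumes "S \<in> tens (dfield eta)" "\<forall>g\<in>K. act2 g S = S"
  shows "diag S \<in> invariants K"
  using assms diag_tens[OF diff_subfield_dfield assms(1)] diag_act2[OF in_SL2 assms(1)]
  by (auto simp: invariants_def)

lemma regular_invariant_kernels_kdx:
  assumes k: "k \<in> regular_invariant_kernels K"
  shows "kdx k \<in> regular_invariant_kernels K"
proof (cases k)
  case (fields A P S Q)
  note L = diff_subfield_invariants[OF K]
  have S: "S \<in> tens (dfield eta)" "\<forall>g\<in>K. act2 g S = S" and Q: "coeffs_in (invariants K) Q"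
    using k by (auto simp: fields regular_invariant_kernels_iff)
  have "coeffs_in (invariants K) (map_poly D Q + pCons 0 Q + [:2 * diag S:])"
    using Q diag_invariant[OF S]
    by (intro coeffs_in_add coeffs_in_map_D L)
      (auto simp: coeffs_in_pCons[OF L] coeffs_in_0[OF L] diff_subfield_0[OF L]
        intro!: diff_subfieldD(4)[OF L] diff_subfield_numeral[OF L])
  then show ?thesis
    using k by (auto simp: fields regular_invariant_kernels_iff act2_Dx[OF in_SL2]
        tens_Dx[OF diff_subfield_dfield])
qed

lemma regular_invariant_kernels_kdy:
  assumes k: "k \<in> regular_invariant_kernels K"
  shows "kdy k \<in> regular_invariant_kernels K"
proof (cases k)
  case (fields A P S Q)
  note L = diff_subfield_invariants[OF K]
  have S: "S \<in> tens (dfield eta)" "\<forall>g\<in>K. act2 g S = S" and Q: "coeffs_in (invariants K) Q"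
    using k by (auto simp: fields regular_invariant_kernels_iff)
  have "coeffs_in (invariants K) (- pCons 0 Q - [:2 * diag S:])"
    using Q diag_invariant[OF S]
    by (intro coeffs_in_diff coeffs_in_uminus L)
      (auto simp: coeffs_in_pCons[OF L] coeffs_in_0[OF L] diff_subfield_0[OF L]
        intro!: diff_subfieldD(4)[OF L] diff_subfield_numeral[OF L])
  then show ?thesis
    using k by (auto simp: fields regular_invariant_kernels_iff act2_Dy[OF in_SL2]
        tens_Dy[OF diff_subfield_dfield])
qed

text \<open>Turns closure of a whole field into a check on a generator. Membership of
  \<open>F\<close> in the invariants is carried along because the Leibniz rule multiplies kernels by
  \<open>at_x F\<close>.\<close>

lemma diff_subfield_bracket_left:
  "diff_subfield {D} {F \<in> invariants K. bracket F G \<in> regular_invariant_kernels K}"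
proof -
  let ?M = "regular_invariant_kernels K"
  note L = diff_subfield_invariants[OF K]
  have mult: "bracket (F * F') G \<in> ?M"
    if "F \<in> invariants K" "F' \<in> invariants K" "bracket F G \<in> ?M" "bracket F' G \<in> ?M" for F F'
    unfolding bracket_mult_left using that
    by (intro regular_invariant_kernels_add regular_invariant_kernels_kscale tens_at_x)
  have add: "bracket (F + F') G \<in> ?M" if "bracket F G \<in> ?M" "bracket F' G \<in> ?M" for F F'
    unfolding bracket_add_left using that by (rule regular_invariant_kernels_add)
  have cst: "bracket (cst c) G \<in> ?M" for c
    by (simp add: regular_invariant_kernels_0)
  have diff: "bracket (F - F') G \<in> ?M"
    if "F \<in> invariants K" "F' \<in> invariants K" "bracket F G \<in> ?M" "bracket F' G \<in> ?M" for F F'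
  proof -
    \<comment> \<open>Reduces subtraction to the cases of sums, products and constants.\<close>
    have eq: "F - F' = F + cst (- 1) * F'" by (simp add: cst_uminus)
    show ?thesis unfolding eq by (intro add mult cst that diff_subfieldD(1)[OF L])
  qed
  have divide: "bracket (F / F') G \<in> ?M"
    if "F \<in> invariants K" "F' \<in> invariants K" "bracket F G \<in> ?M" "bracket F' G \<in> ?M" for F F'
  proof (cases "F' = 0")
    case True
    then show ?thesis using cst[of 0] by simp
  next
    case False
    show ?thesis
      unfolding bracket_divide_left[OF False] using that
      by (intro regular_invariant_kernels_add regular_invariant_kernels_kscale tens_at_x
          diff_subfield_uminus[OF L] diff_subfieldD(5)[OF L] diff_subfield_1[OF L])
  qed
  have D: "bracket (D F) G \<in> ?M" if "bracket F G \<in> ?M" for F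
    unfolding bracket_D_left using that by (rule regular_invariant_kernels_kdx)
  show ?thesis
    unfolding diff_subfield_def
    using mult add diff divide cst D diff_subfieldD[OF L] by auto
qed

lemma diff_subfield_bracket_right:
  "diff_subfield {D} {G \<in> invariants K. bracket F G \<in> regular_invariant_kernels K}"
proof -
  let ?M = "regular_invariant_kernels K"
  note L = diff_subfield_invariants[OF K]
  have mult: "bracket F (G * G') \<in> ?M"
    if "G \<in> invariants K" "G' \<in> invariants K" "bracket F G \<in> ?M" "bracket F G' \<in> ?M" for G G'
    unfolding bracket_mult_right using that
    by (intro regular_invariant_kernels_add regular_invariant_kernels_kscale tens_at_y)
  have add: "bracket F (G + G') \<in> ?M" if "bracket F G \<in> ?M" "bracket F G' \<in> ?M" for G G'
    unfolding bracket_add_right using that by (rule regular_invariant_kernels_add)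
  have cst: "bracket F (cst c) \<in> ?M" for c
    by (simp add: regular_invariant_kernels_0)
  have diff: "bracket F (G - G') \<in> ?M"
    if "G \<in> invariants K" "G' \<in> invariants K" "bracket F G \<in> ?M" "bracket F G' \<in> ?M" for G G'
  proof -
    have eq: "G - G' = G + cst (- 1) * G'" by (simp add: cst_uminus)
    show ?thesis unfolding eq by (intro add mult cst that diff_subfieldD(1)[OF L])
  qed
  have divide: "bracket F (G / G') \<in> ?M"
    if "G \<in> invariants K" "G' \<in> invariants K" "bracket F G \<in> ?M" "bracket F G' \<in> ?M" for G G'
  proof (cases "G' = 0")
    case True
    then show ?thesis using cst[of 0] by simp
  next
    case False
    show ?thesis
      unfolding bracket_divide_right[OF False] using that
      by (intro regular_invariant_kernels_add regular_invariant_kernels_kscale tens_at_y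
          diff_subfield_uminus[OF L] diff_subfieldD(5)[OF L] diff_subfield_1[OF L])
  qed
  have D: "bracket F (D G) \<in> ?M" if "bracket F G \<in> ?M" for G
    unfolding bracket_D_right using that by (rule regular_invariant_kernels_kdy)
  show ?thesis
    unfolding diff_subfield_def
    using mult add diff divide cst D diff_subfieldD[OF L] by auto
qed

text \<open>Two passes: first the left argument runs through the field with the generator on the
  right, then the right argument with an arbitrary left one.\<close>

lemma poisson_dfield_invariants:
  assumes gen: "invariants K = dfield f" and f: "bracket f f \<in> regular_invariant_kernels K"
  shows "poisson_dfield (C_eta_inv K)"
proof -
  have f_in: "f \<in> invariants K" by (simp add: gen)
  have left: "dfield f \<subseteq> {F \<in> invariants K. bracket F f \<in> regular_invariant_kernels K}"
    using f f_in by (intro dfield_least diff_subfield_bracket_left) auto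
  have "bracket F G \<in> regular_invariant_kernels K" if F: "F \<in> dfield f" and G: "G \<in> dfield f" for F G
  proof -
    have "dfield f \<subseteq> {G \<in> invariants K. bracket F G \<in> regular_invariant_kernels K}"
      using F left f_in by (intro dfield_least diff_subfield_bracket_right) auto
    then show ?thesis using G by auto
  qed
  then show ?thesis
    using regular_invariant_kernels_subset[of K] diff_subfield_invariants[OF K]
    by (auto simp: poisson_dfield_def C_eta_inv_def gen)
qed

end

lemma poisson_inclusion_antimono:
  assumes "K \<subseteq> K'" "poisson_dfield (C_eta_inv K)" "poisson_dfield (C_eta_inv K')"
  shows "C_eta_inv K' \<hookrightarrow>\<^sub>P C_eta_inv K"
proof -
  have "invariant_kernels K' \<subseteq> invariant_kernels K"
    using assms(1) invariants_antimono[OF assms(1)] unfolding invariant_kernels_def by blast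
  then show ?thesis
    using assms invariants_antimono[OF assms(1)] by (simp add: poisson_inclusion_def C_eta_inv_def)
qed


section \<open>Explicit brackets\<close>

text \<open>The mixed derivative kills eta(y)^2 - eta(x)^2, and (eta(x) - eta(y))^2 vanishes to
  second order on the diagonal, so differentiating sign(x-y) leaves no delta term.\<close>

lemma bracket_theta_theta: "bracket theta theta = (0, 0, - (2 * at_x theta * at_y theta), 0)"
  unfolding theta_def bracket_D_left bracket_D_right bracket_eta_eta
  by (simp add: Dx_rules Dy_rules algebra_simps)

lemma bracket_log_deriv_left:
  "f \<noteq> 0 \<Longrightarrow> bracket (D f / f) G =
    at_x (1 / f) \<odot> (kdx (bracket f G) + at_x (- (D f / f)) \<odot> bracket f G)"
  unfolding bracket_D_left[symmetric] by (rule bracket_divide_left)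

lemma bracket_log_deriv_right:
  "f \<noteq> 0 \<Longrightarrow> bracket F (D f / f) =
    at_y (1 / f) \<odot> (kdy (bracket F f) + at_y (- (D f / f)) \<odot> bracket F f)"
  unfolding bracket_D_right[symmetric] by (rule bracket_divide_right)

text \<open>With q = eta(x)/eta(y), the inner factors are q - 1/q and q + 1/q, which scalings fix.
  They are written with inverses at separate points so that they visibly lie in
  \<open>tens\<close>.\<close>

lemma bracket_log_deriv_eta:
  "bracket log_deriv_eta log_deriv_eta =
    (at_x log_deriv_eta * at_y log_deriv_eta *
       (at_x (inverse eta) * at_y (inverse eta) * ((at_x eta)\<^sup>2 - (at_y eta)\<^sup>2)), 0,
     - (at_x log_deriv_eta * at_y log_deriv_eta *
       (at_x (inverse eta) * at_y (inverse eta) * ((at_x eta)\<^sup>2 + (at_y eta)\<^sup>2))), 0)"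
proof -
  define l r where "l = log_deriv_eta" and "r = inverse eta"
  have l: "l = D eta / eta" and D_eta': "D eta = l * eta" and r: "1 / eta = r"
    using eta_neq_0 by (simp_all add: l_def r_def log_deriv_eta_def D_eta divide_inverse)
  have "bracket l eta =
      at_x r \<odot> (kdx (bracket eta eta) + at_x (- l) \<odot> bracket eta eta)"
    using bracket_log_deriv_left[OF eta_neq_0, of eta] by (simp only: l[symmetric] r)
  also have "\<dots> = (- (at_x l * at_x r * ((at_x eta)\<^sup>2 + (at_y eta)\<^sup>2)), 0,
      at_x l * at_x r * ((at_x eta)\<^sup>2 - (at_y eta)\<^sup>2), 0)"
    by (simp add: bracket_eta_eta kscale_eq Dx_rules D_eta' algebra_simps power2_eq_square)
  finally have le: "bracket l eta = (- (at_x l * at_x r * ((at_x eta)\<^sup>2 + (at_y eta)\<^sup>2)), 0,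
      at_x l * at_x r * ((at_x eta)\<^sup>2 - (at_y eta)\<^sup>2), 0)" .
  have "bracket l l = at_y r \<odot> (kdy (bracket l eta) + at_y (- l) \<odot> bracket l eta)"
    using bracket_log_deriv_right[OF eta_neq_0, of l] by (simp only: l[symmetric] r)
  also have "\<dots> =
    (at_x l * at_y l * (at_x r * at_y r * ((at_x eta)\<^sup>2 - (at_y eta)\<^sup>2)), 0,
     - (at_x l * at_y l * (at_x r * at_y r * ((at_x eta)\<^sup>2 + (at_y eta)\<^sup>2))), 0)"
    by (simp add: le kscale_eq Dy_rules D_eta' algebra_simps power2_eq_square)
  finally show ?thesis by (simp only: l_def r_def)
qed

text \<open>Heuristically, log theta has bracket -2 sign(x-y) with itself; d/dx turns this into -4
  delta(x-y) and d/dy into 4 delta'(x-y).\<close>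

lemma bracket_log_deriv_theta: "bracket (D theta / theta) (D theta / theta) = (0, 0, 0, [:0, 4:])"
proof -
  define l where "l = D theta / theta"
  have D_th: "D theta = l * theta" using theta_neq_0 by (simp add: l_def)
  have "bracket l theta = (0, 0, 0, [:- 4 * theta:])"
  proof -
    have "bracket l theta = at_x (1 / theta) \<odot> (kdx (bracket theta theta) + at_x (- l) \<odot> bracket theta theta)"
      unfolding l_def by (rule bracket_log_deriv_left[OF theta_neq_0])
    also have "kdx (bracket theta theta) + at_x (- l) \<odot> bracket theta theta =
        (0, 0, 0, [:- 4 * theta * theta:])"
      by (simp add: bracket_theta_theta kscale_eq Dx_rules D_th)
    also have "at_x (1 / theta) \<odot> \<dots> = (0, 0, 0, [:- 4 * theta:])"
      using theta_neq_0 by (simp add: kscale_eq del: at_x_hom)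
    finally show ?thesis .
  qed
  moreover have "bracket l l = at_y (1 / theta) \<odot> (kdy (bracket l theta) + at_y (- l) \<odot> bracket l theta)"
    using bracket_log_deriv_right[OF theta_neq_0, of l] by (simp only: l_def[symmetric])
  ultimately have "bracket l l = at_y (1 / theta) \<odot> (0, 0, 0, [:4 * l * theta, 4 * theta:])"
    by (simp add: kscale_eq scale_delta_pCons Dy_rules del: at_y_hom)
  \<comment> \<open>Moving 1/theta from y to x in front of delta' adds its derivative times delta,
    and this cancels the term \<open>4 * l * theta\<close>.\<close>
  also have "D (1 / theta) = - l / theta"
    using theta_neq_0 by (simp add: D_divide D_rules D_th power2_eq_square)
  then have "at_y (1 / theta) \<odot> (0, 0, 0, [:4 * l * theta, 4 * theta:]) = (0, 0, 0, [:0, 4:])"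
    using theta_neq_0 by (simp add: kscale_eq scale_delta_pCons del: at_y_hom)
  finally show ?thesis by (simp only: l_def)
qed

lemma half_tens [simp]: "1/2 \<in> tens UNIV"
  using tens_at_x[of "1/2" UNIV] by simp

lemma scale_delta_half [simp]: "scale_delta (1/2) Q = Polynomial.smult (1/2) Q"
  using scale_delta_at_x[of "1/2" Q] by (simp del: scale_delta_at_x)

lemma bracket_v_v: "bracket v_inv v_inv = (0, 0, 0, [:0, 1:])"
proof -
  have v: "v_inv = cst (1/2) * (D theta / theta)"
    by (simp add: v_inv_theta cst_divide cst_numeral)
  have half: "cst (1/2) = (1/2 :: twopt)"
    by (simp add: cst_divide cst_numeral)
  show ?thesis
    unfolding v bracket_mult_left bracket_mult_right bracket_log_deriv_theta
    by (simp add: half kscale_eq)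
qed

lemma bracket_uminus_left: "bracket (- F) G = - bracket F G"
  using bracket_add_left[of F "- F" G] bracket_cst_left[of 0 G]
  by (simp add: eq_neg_iff_add_eq_0 add.commute del: bracket_cst_left)

lemma bracket_uminus_right: "bracket F (- G) = - bracket F G"
  using bracket_add_right[of F G "- G"] bracket_cst_right[of F 0]
  by (simp add: eq_neg_iff_add_eq_0 add.commute del: bracket_cst_right)

lemma bracket_diff_left: "bracket (F - F') G = bracket F G - bracket F' G"
  using bracket_add_left[of F "- F'" G] by (simp add: bracket_uminus_left)

lemma bracket_diff_right: "bracket F (G - G') = bracket F G - bracket F G'"
  using bracket_add_right[of F G "- G'"] by (simp add: bracket_uminus_right)

lemma bracket_u_u: "bracket u_inv u_inv = (0, 0, 0, [:- (2 * D u_inv), - (4 * u_inv), 0, - 1:])"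
  unfolding u_inv_v power2_eq_square
  by (simp add: bracket_diff_left bracket_diff_right bracket_mult_left bracket_mult_right
      bracket_D_left bracket_D_right bracket_v_v kscale_eq scale_delta_pCons Dx_rules Dy_rules D_rules
      map_poly_pCons_0 algebra_simps)

lemma delta_ker_1: "delta_ker 1 = (0, 0, 0, [:0, 1:])"
  and delta_ker_3: "delta_ker 3 = (0, 0, 0, [:0, 0, 0, 1:])"
  by (simp_all add: delta_ker_def monom_Suc monom_0 numeral_3_eq_3)

text \<open>Since u(y) delta'(x-y) = u(x) delta'(x-y) + u'(x) delta(x-y), the symmetric expression
  has the coefficients 2 u and u' at x.\<close>

lemma bracket_u_u_delta:
  "(- 2) \<odot> ((1/2) \<odot> delta_ker 3 + (at_x u_inv + at_y u_inv) \<odot> delta_ker 1) =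
    (0, 0, 0, [:- (2 * D u_inv), - (4 * u_inv), 0, - 1:])"
proof -
  have "(1/2) \<odot> delta_ker 3 = (0, 0, 0, [:0, 0, 0, 1/2:])"
    unfolding delta_ker_3 kscale_eq scale_delta_half by simp
  moreover have "(at_x u_inv + at_y u_inv) \<odot> delta_ker 1 = (0, 0, 0, [:D u_inv, 2 * u_inv:])"
    unfolding delta_ker_1 by (simp add: kscale_eq scale_delta_pCons Dy_rules)
  ultimately show ?thesis
    by (simp only:) (simp add: kscale_eq scale_delta_pCons Dy_rules)
qed

text \<open>The prefactors -1, -1, 2 and -2 are the exact constants for the given R and the rule
  sign' = 2 delta. The sign coefficient of {eta, eta} is +(eta(x) - eta(y))^2, whose mixed
  derivative is -2 theta(x) theta(y). The resulting 4 delta' for theta'/theta becomes delta' for v,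
  and the leading term of {u, u} is the mixed derivative -delta''' of delta'.\<close>

theorem proposition2p13:
  shows
    "(C_eta_inv SL2 \<hookrightarrow>\<^sub>P C_eta_inv lower_B \<and>
      C_eta_inv lower_B \<hookrightarrow>\<^sub>P C_eta_inv diag_H \<and>
      C_eta_inv diag_H \<hookrightarrow>\<^sub>P C_eta \<and>
      C_eta_inv lower_B \<hookrightarrow>\<^sub>P C_eta_inv lower_N \<and>
      C_eta_inv lower_N \<hookrightarrow>\<^sub>P C_eta \<and>
      C_eta_inv lower_B \<hookrightarrow>\<^sub>P C_eta) \<and>
     (bracket eta eta =
        - (fun_ker ((at_x eta)\<^sup>2 - (at_y eta)\<^sup>2) - (at_x eta - at_y eta)\<^sup>2 \<odot> sign_ker)) \<and>
     (invariants lower_N = dfield theta \<and>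
      bracket theta theta = - ((2 * at_x theta * at_y theta) \<odot> sign_ker)) \<and>
     (v_inv = 1/2 * (D theta / theta) \<and>
      invariants lower_B = dfield v_inv \<and>
      bracket v_inv v_inv = 2 \<odot> ((1/2) \<odot> delta_ker 1)) \<and>
     (u_inv = D v_inv - v_inv\<^sup>2 \<and>
      invariants SL2 = dfield u_inv \<and>
      bracket u_inv u_inv =
        (- 2) \<odot> ((1/2) \<odot> delta_ker 3 + (at_x u_inv + at_y u_inv) \<odot> delta_ker 1))"
proof -
  have inv_eta: "invariants {} = dfield eta"
    by (simp add: invariants_def)
  note L = diff_subfield_dfield
  have eta: "poisson_dfield C_eta"
  proof (rule poisson_dfield_invariants[OF _ inv_eta])
    show "bracket eta eta \<in> regular_invariant_kernels {}"
      unfolding bracket_eta_eta regular_invariant_kernels_iff inv_eta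
      by (auto intro!: tens_diff[OF L] tens_power[OF L] tens_at_x tens_at_y coeffs_in_0[OF L])
  qed simp
  have H: "poisson_dfield (C_eta_inv diag_H)"
  proof (rule poisson_dfield_invariants[OF subgroups_SL2(3) invariants_diag_H])
    let ?c = "at_x (inverse eta) * at_y (inverse eta)"
    have fixed: "act2 g (at_x log_deriv_eta) = at_x log_deriv_eta"
      "act2 g (at_y log_deriv_eta) = at_y log_deriv_eta"
      "act2 g (?c * ((at_x eta)\<^sup>2 - (at_y eta)\<^sup>2)) = ?c * ((at_x eta)\<^sup>2 - (at_y eta)\<^sup>2)"
      "act2 g (?c * ((at_x eta)\<^sup>2 + (at_y eta)\<^sup>2)) = ?c * ((at_x eta)\<^sup>2 + (at_y eta)\<^sup>2)"
      if gH: "g \<in> diag_H" for g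
    proof -
      have g: "g \<in> SL2" using gH subgroups_SL2 by auto
      have e: "g $ 1 $ 2 = 0" "g $ 2 $ 1 = 0" "g $ 1 $ 1 \<noteq> 0" "g $ 2 $ 2 \<noteq> 0"
        using gH by (auto simp: diag_H_def SL2_def det_2)
      show "act2 g (at_x log_deriv_eta) = at_x log_deriv_eta"
        "act2 g (at_y log_deriv_eta) = at_y log_deriv_eta"
        using gH log_deriv_eta_invariant
        by (simp_all add: act2_at_x[OF g] act2_at_y[OF g] invariants_def)
      show "act2 g (?c * ((at_x eta)\<^sup>2 - (at_y eta)\<^sup>2)) = ?c * ((at_x eta)\<^sup>2 - (at_y eta)\<^sup>2)"
        "act2 g (?c * ((at_x eta)\<^sup>2 + (at_y eta)\<^sup>2)) = ?c * ((at_x eta)\<^sup>2 + (at_y eta)\<^sup>2)"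
        using e eta_neq_0
        by (simp_all add: act2_hom[OF g] act2_at_x[OF g] act2_at_y[OF g] act_eta[OF g] field_simps
              power2_eq_square)
    qed
    \<comment> \<open>The last factor is fixed by the torus only as a whole, since eta(x) and eta(y)
      are rescaled; the products are therefore split no further than into these three
      factors.\<close>
    have prods: "act2 g (a * b * c) = act2 g a * act2 g b * act2 g c"
      "act2 g (- (a * b * c)) = - (act2 g a * act2 g b * act2 g c)"
      if "g \<in> diag_H" for g a b c
      using that subgroups_SL2(3) act2_hom[of g] by auto
    have "\<forall>g\<in>diag_H. act2 g (at_x log_deriv_eta * at_y log_deriv_eta * (?c * ((at_x eta)\<^sup>2 - (at_y eta)\<^sup>2))) =
          at_x log_deriv_eta * at_y log_deriv_eta * (?c * ((at_x eta)\<^sup>2 - (at_y eta)\<^sup>2)) \<and>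
        act2 g (- (at_x log_deriv_eta * at_y log_deriv_eta * (?c * ((at_x eta)\<^sup>2 + (at_y eta)\<^sup>2)))) =
          - (at_x log_deriv_eta * at_y log_deriv_eta * (?c * ((at_x eta)\<^sup>2 + (at_y eta)\<^sup>2)))"
      by (intro ballI conjI) (subst prods, assumption, simp only: fixed)+
    then show "bracket log_deriv_eta log_deriv_eta \<in> regular_invariant_kernels diag_H"
      unfolding bracket_log_deriv_eta regular_invariant_kernels_iff invariants_diag_H
      by (intro conjI refl) (assumption | intro tens_diff[OF L] tens_uminus[OF L] tens.intros
        tens_power[OF L] coeffs_in_0[OF L] diff_subfield_inverse[OF L] dfield_generator log_deriv_eta_in)+
  qed
  have N: "poisson_dfield (C_eta_inv lower_N)"
  proof (rule poisson_dfield_invariants[OF subgroups_SL2(2) invariants_lower_N])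
    let ?S = "- (2 * at_x theta * at_y theta)"
    have "?S \<in> tens (invariants lower_N)"
      unfolding invariants_lower_N
      by (intro tens_uminus[OF L] tens.intros tens_numeral[OF L] dfield_generator)
    then show "bracket theta theta \<in> regular_invariant_kernels lower_N"
      unfolding bracket_theta_theta regular_invariant_kernels_iff
      using act2_tens_invariants[OF subgroups_SL2(2)] tens_mono[OF _ invariants_subset_dfield_eta]
        regular_invariant_kernels_0[OF subgroups_SL2(2)]
      by (auto simp: zero_kernel regular_invariant_kernels_iff)
  qed
  have B: "poisson_dfield (C_eta_inv lower_B)"
  proof (rule poisson_dfield_invariants[OF subgroups_SL2(1) invariants_lower_B])
    show "bracket v_inv v_inv \<in> regular_invariant_kernels lower_B"
      using regular_invariant_kernels_0[OF subgroups_SL2(1)] diff_subfield_0[OF L] diff_subfield_1[OF L]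
      by (simp add: bracket_v_v zero_kernel regular_invariant_kernels_iff invariants_lower_B
          coeffs_in_pCons[OF L])
  qed
  have G: "poisson_dfield (C_eta_inv SL2)"
  proof (rule poisson_dfield_invariants[OF order_refl invariants_SL2])
    have "- (2 * D u_inv) \<in> dfield u_inv" "- (4 * u_inv) \<in> dfield u_inv" "- 1 \<in> dfield u_inv"
      by (intro dfield_intros dfield_generator)+
    then show "bracket u_inv u_inv \<in> regular_invariant_kernels SL2"
      using regular_invariant_kernels_0[OF order_refl] diff_subfield_0[OF L]
      by (simp add: bracket_u_u zero_kernel regular_invariant_kernels_iff invariants_SL2
          coeffs_in_pCons[OF L])
  qed
  have "bracket eta eta =
      - (fun_ker ((at_x eta)\<^sup>2 - (at_y eta)\<^sup>2) - (at_x eta - at_y eta)\<^sup>2 \<odot> sign_ker)"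
    by (simp add: bracket_eta_eta fun_ker_def sign_ker_def kscale_eq)
  moreover have "bracket theta theta = - ((2 * at_x theta * at_y theta) \<odot> sign_ker)"
    by (simp add: bracket_theta_theta sign_ker_def kscale_eq)
  moreover have "bracket v_inv v_inv = 2 \<odot> ((1/2) \<odot> delta_ker 1)"
    unfolding bracket_v_v delta_ker_1 by (simp flip: kscale_mult)
  ultimately show ?thesis
    using eta H N B G subgroups_SL2 invariants_lower_N v_inv_theta invariants_lower_B u_inv_v
      invariants_SL2 bracket_u_u bracket_u_u_delta
    by (auto intro!: poisson_inclusion_antimono)
qed

end
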